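(* The function $H\mapsto\mathsf{V}(H,t)$, $H\in[0,1]$, behaves as follows: (i) Let $t\in(0,\tau_1]$. Then $\mathsf{V}(H,t)$ decreases for $H\in[0,1]$. (ii) Let $t\in(\tau_1,\tau_{1/2}]$. Then there exists $H_t$ with $1/2<H_t<1$ such that $\mathsf{V}(H,t)$ decreases for $H\in[0,H_t]$ and increases for $H\in[H_t,1]$. (iii) Let $t>\tau_{1/2}$. Then there exists $\widehat{H}_t$ with $0<\widehat{H}_t<1/2$ such that $\mathsf{V}(H,t)$ decreases for $H\in[0,\widehat{H}_t]$ and increases for $H\in[\widehat{H}_t,1]$.
   Context: For $H\in(0,1)$, $B^H=\{B^H_t, t\ge 0\}$ is a fractional Brownian motion with Hurst index $H$: a zero-mean Gaussian process (with continuous paths) with covariance $\mathsf{E}B^H_tB^H_s=\frac12(t^{2H}+s^{2H}-|t-s|^{2H})$. Define $X^H_t=\int_0^t e^s\,dB^H_s = e^tB^H_t-\int_0^t e^sB^H_s\,ds$, $t\ge 0$, and $\mathsf{V}(H,t)=\mathsf{E}(X^H_t)^2$. For the boundary values the process is extended (by limits of covariances) so that $\mathsf{V}(0,t)=\frac{e^{2t}+1}{2}$ for $t>0$ and $\mathsf{V}(1,t)=(e^t-1)^2$. The numbers $\tau_1$ and $\tau_{1/2}$, which satisfy $\tau_{1/2}>\log 3>\tau_1>1$, denote the unique $t>0$ at which $\frac{\partial \mathsf{V}}{\partial H}(1,t)=0$ (one-sided derivative at $H=1$), respectively $\frac{\partial \mathsf{V}}{\partial H}(1/2,t)=0$; each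 of these derivatives is negative before, and positive after, the corresponding point.
   Formalization: In (ii), at the single endpoint t = τ_{1/2} the claim 1/2 < H_t is replaced by 1/2 ≤ H_t, since there the strictly convex function V(·,t) has its minimum exactly at H = 1/2 and the printed strict inequality is false; for t < τ_{1/2} it is unchanged. *)

theory Defs
  imports "HOL-Probability.Probability"
begin

text \<open>Gaussian laws may be degenerate; this is needed for instance for B at time 0.\<close>

definition gaussian_rv :: "'a measure \<Rightarrow> ('a \<Rightarrow> real) \<Rightarrow> bool" where
  "gaussian_rv M X \<longleftrightarrow> X \<in> borel_measurable M \<and>
     (\<exists>\<mu> \<sigma>. \<sigma> \<ge> 0 \<and>
        distr M borel X =
          (if \<sigma> = 0 then return borel \<mu> else density lborel (\<lambda>x. ennreal (normal_density \<mu> \<sigma> x))))"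

definition gaussian_process :: "'a measure \<Rightarrow> 'i set \<Rightarrow> ('i \<Rightarrow> 'a \<Rightarrow> real) \<Rightarrow> bool" where
  "gaussian_process M T X \<longleftrightarrow>
     (\<forall>F c. finite F \<and> F \<subseteq> T \<longrightarrow> gaussian_rv M (\<lambda>\<omega>. \<Sum>t\<in>F. c t * X t \<omega>))"

locale fractional_brownian_motion = prob_space M
  for M :: "'a measure" and H :: real and B :: "real \<Rightarrow> 'a \<Rightarrow> real" +
  assumes hurst: "0 < H" "H < 1"
    and gaussian: "gaussian_process M {0..} B"
    and zero_mean: "\<And>t. 0 \<le> t \<Longrightarrow> expectation (B t) = 0"
    and covariance: "\<And>t s. 0 \<le> t \<Longrightarrow> 0 \<le> s \<Longrightarrow>
      expectation (\<lambda>\<omega>. B t \<omega> * B s \<omega>) =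
        (t powr (2 * H) + s powr (2 * H) - \<bar>t - s\<bar> powr (2 * H)) / 2"
    and continuous_paths: "\<And>\<omega>. \<omega> \<in> space M \<Longrightarrow> continuous_on {0..} (\<lambda>t. B t \<omega>)"

text \<open>The integral of \<open>exp s\<close> against \<open>dB s\<close> over \<open>[0, t]\<close>, defined pathwise by
  integration by parts.\<close>

definition exp_integral :: "(real \<Rightarrow> 'a \<Rightarrow> real) \<Rightarrow> real \<Rightarrow> 'a \<Rightarrow> real" where
  "exp_integral B t \<omega> = exp t * B t \<omega> - (LBINT s:{0..t}. exp s * B s \<omega>)"

text \<open>Here \<open>B H\<close> is a process on the probability space \<open>M H\<close>, for each \<open>H\<close> in \<open>(0, 1)\<close>.
  The values at \<open>H = 0\<close> and \<open>H = 1\<close> are those of the extension of the process by limits of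
  covariances; the value at \<open>H = 0\<close> is the intended one for \<open>t > 0\<close> only, and the function is
  meaningless for \<open>H\<close> outside \<open>[0, 1]\<close>.\<close>

definition V :: "(real \<Rightarrow> 'a measure) \<Rightarrow> (real \<Rightarrow> real \<Rightarrow> 'a \<Rightarrow> real) \<Rightarrow> real \<Rightarrow> real \<Rightarrow> real" where
  "V M B H t =
     (if H = 0 then (exp (2 * t) + 1) / 2
      else if H = 1 then (exp t - 1)\<^sup>2
      else prob_space.expectation (M H) (\<lambda>\<omega>. (exp_integral (B H) t \<omega>)\<^sup>2))"

text \<open>The unique positive zeros in \<open>t\<close> of the derivative of \<open>V\<close> in \<open>H\<close>, at \<open>H = 1\<close> (one-sided)
  and at \<open>H = 1/2\<close>. Existence and uniqueness are not built into these definitions.\<close>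

definition tau_one :: "(real \<Rightarrow> 'a measure) \<Rightarrow> (real \<Rightarrow> real \<Rightarrow> 'a \<Rightarrow> real) \<Rightarrow> real" where
  "tau_one M B =
     (THE t. 0 < t \<and> ((\<lambda>H. V M B H t) has_real_derivative 0) (at 1 within {0..1}))"

definition tau_half :: "(real \<Rightarrow> 'a measure) \<Rightarrow> (real \<Rightarrow> real \<Rightarrow> 'a \<Rightarrow> real) \<Rightarrow> real" where
  "tau_half M B =
     (THE t. 0 < t \<and> ((\<lambda>H. V M B H t) has_real_derivative 0) (at (1/2)))"

end

theory Submission
  imports Defs "HOL-Real_Asymp.Real_Asymp"
begin

text \<open>Put $p = 2H$. Inserting the covariance of fractional Brownian motion and carrying out the
  integrations by parts collapses the double integral in the variance of
  $X_t = e^t B_t - \int_0^t e^s B_s\,ds$ to a single one: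
  \[ \mathsf{V}(H,t) = e^t \Bigl( t^p + \int_0^t \sinh(t-r)\, r^p \,dr \Bigr), \]
  the operator \<open>volterra\<close> below applied to $r \mapsto r^p$ (lemma \<open>variance_exp_integral\<close>). The same
  formula with $r^0 = 1$ gives the boundary value at $H = 0$ and with $r^2$ the one at $H = 1$. This
  operator is linear and increasing, so pointwise facts about powers turn into facts about the
  variance.

  Since $p \mapsto r^p$ is convex, so is the variance as a function of $H$; its derivative
  is twice the operator applied to $r^p \ln r$, and it is strictly increasing in $H$
  (\<open>volterra_powr_ln_strict_mono\<close>). Hence for fixed $t$ the variance decreases as long as this
  derivative is negative and increases afterwards, and the three cases of the theorem are read off from
  its signs at $H = 1$, at $H = 1/2$ and near $H = 0$. Near $0$ the derivative is negative
  for every $t$, because the variance at $H = 1/2$ lies below the one at $H = 0$ by exactly $1$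
  (\<open>volterra_powr_ln_neg_near_zero\<close>).

  What remains is that for fixed $p \ge 1$, in particular for $p = 1$ and $p = 2$, the function
  $J(t)$ given by the operator applied to $f(r) = r^p \ln r$ changes sign exactly once, from
  negative to positive; this also shows that the two definite descriptions in \<open>tau_half\<close> and
  \<open>tau_one\<close> denote the points of sign change. On $(0,1]$ the function $J$ is negative
  because $f$ is. The derivative of $J$ is $e^{2t} K(t)$, where $K$ has derivative $e^{-t} f''(t)$,
  which is positive beyond $1$. So $K$ is increasing there, and once $J$ has climbed from its
  negative value at $1$ to $0$ it keeps increasing (\<open>volterra_single_crossing\<close>). That $J$ does
  become positive is seen at $t = e$, by comparison with the tangent $r - 1$ of $r \ln r$
  (\<open>volterra_powr_ln_pos_exp_one\<close>).\<close>

section \<open>A Volterra operator with hyperbolic sine kernel\<close>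

text \<open>For \<open>f r = r powr (2 * H)\<close> this is the variance of the exponential integral. For smooth
  \<open>f\<close>, the factor multiplying \<open>exp t\<close> is the solution $y$ of $y'' = y + f''$ with $y(0) = f(0)$ and
  $y'(0) = f'(0)$, which explains the hyperbolic functions in the closed forms below.\<close>

definition volterra :: "(real \<Rightarrow> real) \<Rightarrow> real \<Rightarrow> real" where
  "volterra f t = exp t * (f t + integral {0..t} (\<lambda>r. sinh (t - r) * f r))"

lemma continuous_on_sinh_mult:
  fixes f :: "real \<Rightarrow> real"
  assumes "continuous_on {0..t} f"
  shows "continuous_on {0..t} (\<lambda>r. sinh (t - r) * f r)"
  by (intro continuous_intros assms)

lemma volterra_cong:
  assumes "0 \<le> t" "\<And>r. 0 \<le> r \<Longrightarrow> r \<le> t \<Longrightarrow> f r = g r"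
  shows "volterra f t = volterra g t"
proof -
  have "integral {0..t} (\<lambda>r. sinh (t - r) * f r) = integral {0..t} (\<lambda>r. sinh (t - r) * g r)"
    using assms(2) by (intro integral_cong) auto
  then show ?thesis using assms by (simp only: volterra_def)
qed

lemma volterra_diff:
  assumes "continuous_on {0..t} f" "continuous_on {0..t} g"
  shows "volterra (\<lambda>r. f r - g r) t = volterra f t - volterra g t"
proof -
  have "integral {0..t} (\<lambda>r. sinh (t - r) * (f r - g r)) =
        integral {0..t} (\<lambda>r. sinh (t - r) * f r) - integral {0..t} (\<lambda>r. sinh (t - r) * g r)"
    unfolding right_diff_distrib
    by (intro integral_diff integrable_continuous_real continuous_on_sinh_mult assms)
  then show ?thesis
    by (simp only: volterra_def) (simp only: algebra_simps)
qed

lemma volterra_ge: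
  assumes "continuous_on {0..t} f" "\<And>r. 0 \<le> r \<Longrightarrow> r \<le> t \<Longrightarrow> 0 \<le> f r"
  shows "exp t * f t \<le> volterra f t"
proof -
  have "0 \<le> integral {0..t} (\<lambda>r. sinh (t - r) * f r)"
    by (intro integral_nonneg integrable_continuous_real continuous_on_sinh_mult assms)
       (auto intro!: mult_nonneg_nonneg assms)
  then show ?thesis by (simp add: volterra_def)
qed

lemma volterra_mono:
  assumes "continuous_on {0..t} f" "continuous_on {0..t} g" "0 \<le> t"
    and "\<And>r. 0 \<le> r \<Longrightarrow> r \<le> t \<Longrightarrow> f r \<le> g r"
  shows "volterra f t \<le> volterra g t"
proof -
  have "exp t * (g t - f t) \<le> volterra (\<lambda>r. g r - f r) t"
    by (rule volterra_ge) (auto intro!: continuous_intros assms)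
  moreover have "0 \<le> exp t * (g t - f t)" using assms by auto
  ultimately show ?thesis using volterra_diff[OF assms(2,1)] by linarith
qed

lemma volterra_strict_mono:
  assumes f: "continuous_on {0..t} f" and g: "continuous_on {0..t} g" and "0 < t"
    and le: "\<And>r. 0 \<le> r \<Longrightarrow> r \<le> t \<Longrightarrow> f r \<le> g r"
    and s: "0 < s" "s < t" "f s < g s"
  shows "volterra f t < volterra g t"
proof -
  let ?h = "\<lambda>r. sinh (t - r) * (g r - f r)"
  have c: "continuous_on {0..t} ?h" by (intro continuous_on_sinh_mult continuous_on_diff f g)
  have nn: "0 \<le> ?h r" if "r \<in> {0..t}" for r
    using that le[of r] by auto
  have "integral {0..t} ?h \<noteq> 0"
  proof
    assume "integral {0..t} ?h = 0"
    then have "\<forall>r\<in>{0..t}. ?h r = 0"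
      by (subst (asm) integral_eq_0_iff[OF c \<open>0 < t\<close> nn])
    then have "?h s = 0" using s by (elim bspec) auto
    then show False using s by auto
  qed
  moreover have "0 \<le> integral {0..t} ?h"
    using nn by (intro integral_nonneg integrable_continuous_real c)
  moreover have "0 \<le> g t - f t" using le[of t] \<open>0 < t\<close> by auto
  ultimately have "0 < volterra (\<lambda>r. g r - f r) t"
    by (auto simp: volterra_def intro!: add_nonneg_pos)
  then show ?thesis using volterra_diff[OF g f] by linarith
qed

text \<open>Repeated integration by parts ends after the second derivative of the polynomial. The cases $1$, $r$
  and $r^2$ are the variances at $H = 0$, $1/2$ and $1$; affine functions serve as bounds of powers.\<close>

lemma volterra_quadratic:
  assumes "0 \<le> t"
  shows "volterra (\<lambda>r. a + b * r + c * r\<^sup>2) t = exp t * (a * cosh t + b * sinh t + 2 * c * (cosh t - 1))"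
proof -
  let ?F = "\<lambda>r. - (a + b * r + c * r\<^sup>2) * cosh (t - r) - (b + 2 * c * r) * sinh (t - r) - 2 * c * cosh (t - r)"
  have "(?F has_real_derivative sinh (t - r) * (a + b * r + c * r\<^sup>2)) (at r within {0..t})" for r
    by (auto intro!: derivative_eq_intros simp: algebra_simps)
  then have "((\<lambda>r. sinh (t - r) * (a + b * r + c * r\<^sup>2)) has_integral ?F t - ?F 0) {0..t}"
    by (intro fundamental_theorem_of_calculus[OF assms])
       (simp only: has_real_derivative_iff_has_vector_derivative)
  moreover have "?F t - ?F 0 =
      a * cosh t + b * sinh t + 2 * c * (cosh t - 1) - (a + b * t + c * t\<^sup>2)"
    by (simp add: algebra_simps)
  ultimately have "integral {0..t} (\<lambda>r. sinh (t - r) * (a + b * r + c * r\<^sup>2)) =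
      a * cosh t + b * sinh t + 2 * c * (cosh t - 1) - (a + b * t + c * t\<^sup>2)"
    by (simp only: integral_unique)
  then show ?thesis
    unfolding volterra_def by (simp only: add_diff_eq add_diff_cancel_left')
qed

lemma exp_double_real: "exp (2 * t) = exp t * exp (t :: real)"
  by (simp only: exp_double power2_eq_square)

lemma exp_cosh_real: "exp t * cosh t = (exp (2 * t) + 1) / (2 :: real)"
proof -
  have "exp t * exp (- t) = 1" by (simp add: exp_minus)
  then show ?thesis
    unfolding exp_double_real cosh_field_def by (simp add: distrib_left)
qed

lemma exp_sinh_real: "exp t * sinh t = (exp (2 * t) - 1) / (2 :: real)"
proof -
  have "exp t * exp (- t) = 1" by (simp add: exp_minus)
  then show ?thesis
    unfolding exp_double_real sinh_field_def by (simp add: right_diff_distrib)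
qed

lemma volterra_one: "0 \<le> t \<Longrightarrow> volterra (\<lambda>r. 1) t = (exp (2 * t) + 1) / 2"
  using volterra_quadratic[of t 1 0 0] exp_cosh_real[of t] by simp

lemma volterra_id: "0 \<le> t \<Longrightarrow> volterra (\<lambda>r. r) t = (exp (2 * t) - 1) / 2"
  using volterra_quadratic[of t 0 1 0] exp_sinh_real[of t] by simp

lemma volterra_square:
  assumes "0 \<le> t"
  shows "volterra (\<lambda>r. r\<^sup>2) t = (exp t - 1)\<^sup>2"
proof -
  have "volterra (\<lambda>r. r\<^sup>2) t = 2 * (exp t * cosh t) - 2 * exp t"
    using volterra_quadratic[OF assms, of 0 0 1] by (simp add: algebra_simps)
  also have "\<dots> = (exp t - 1)\<^sup>2"
    unfolding exp_cosh_real exp_double_real by (simp add: power2_eq_square algebra_simps)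
  finally show ?thesis .
qed

text \<open>Splitting the kernel into its two exponentials removes the parameter $t$ from the integrands,
  so that the operator can be differentiated in $t$ and compared with the integrated covariance.\<close>

lemma volterra_exp:
  assumes "continuous_on {0..t} f"
  shows "volterra f t = exp t * f t + exp (2 * t) / 2 * integral {0..t} (\<lambda>r. exp (- r) * f r)
    - integral {0..t} (\<lambda>r. exp r * f r) / 2"
proof -
  have *: "exp t * (sinh (t - r) * f r) = exp (2 * t) / 2 * (exp (- r) * f r) - 1 / 2 * (exp r * f r)" for r
  proof -
    have "exp t * exp (t - r) = exp (2 * t) * exp (- r)" "exp t * exp (- (t - r)) = exp r"
      by (simp_all flip: exp_add)
    then have "exp t * sinh (t - r) = (exp (2 * t) * exp (- r) - exp r) / 2"
      by (simp only: sinh_field_def times_divide_eq_right right_diff_distrib)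
    then show ?thesis by (simp add: mult.assoc[symmetric] left_diff_distrib diff_divide_distrib)
  qed
  have "exp t * integral {0..t} (\<lambda>r. sinh (t - r) * f r) =
      integral {0..t} (\<lambda>r. exp (2 * t) / 2 * (exp (- r) * f r) - 1 / 2 * (exp r * f r))"
    unfolding integral_mult_right[symmetric] * ..
  also have "\<dots> = integral {0..t} (\<lambda>r. exp (2 * t) / 2 * (exp (- r) * f r))
      - integral {0..t} (\<lambda>r. 1 / 2 * (exp r * f r))"
    by (intro integral_diff integrable_continuous_real continuous_intros assms)
  finally show ?thesis
    unfolding volterra_def distrib_left integral_mult_right by simp
qed

lemma continuous_on_powr_nonneg:
  assumes "0 < p" "S \<subseteq> {0..}"
  shows "continuous_on S (\<lambda>r::real. r powr p)"
  by (rule continuous_on_powr') (use assms in \<open>auto intro!: continuous_intros\<close>)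

lemma continuous_on_powr_ln:
  assumes "0 < p" "S \<subseteq> {0..}"
  shows "continuous_on S (\<lambda>r::real. r powr p * ln r)"
proof -
  have "((\<lambda>r. r powr p * ln r) \<longlongrightarrow> x powr p * ln x) (at x within {0..})" if x: "x \<ge> 0" for x
  proof (cases "x = 0")
    case True
    have "((\<lambda>r::real. r powr p * ln r) \<longlongrightarrow> 0) (at_right 0)"
      using assms by real_asymp
    then show ?thesis
      using True assms by (simp add: at_within_Ici_at_right)
  next
    case False
    then show ?thesis using x
      by (auto intro!: tendsto_intros)
  qed
  then have "continuous_on {0..} (\<lambda>r::real. r powr p * ln r)"
    by (simp add: continuous_on_def)
  then show ?thesis using assms(2) by (rule continuous_on_subset)
qed

text \<open>The exponent is bounded away from $0$, so a fixed power \<open>r powr (q / 2)\<close> can be split off to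
  tame the logarithm at $r = 0$, and the remaining power is still jointly continuous.\<close>

lemma continuous_on_powr_ln_joint:
  assumes "0 < q"
  shows "continuous_on ({q..} \<times> {0..t}) (\<lambda>z::real\<times>real. snd z powr fst z * ln (snd z))"
proof -
  have "continuous_on ({q..} \<times> {0..t}) (\<lambda>z::real\<times>real. snd z powr (fst z - q / 2) * (snd z powr (q / 2) * ln (snd z)))"
    using assms
    by (intro continuous_on_mult continuous_on_powr' continuous_intros
        continuous_on_compose2[OF continuous_on_powr_ln[of "q / 2" "{0..}"], of _ snd]) auto
  then show ?thesis
    by (rule continuous_on_cong[THEN iffD1, rotated -1])
       (auto simp: powr_diff powr_add[symmetric])
qed

lemma DERIV_integral_upper:
  fixes g :: "real \<Rightarrow> real"
  assumes cont: "\<And>T. continuous_on {0..T} g" and "0 < t"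
  shows "((\<lambda>x. integral {0..x} g) has_real_derivative g t) (at t)"
proof -
  have "((\<lambda>x. integral {0..x} g) has_real_derivative g t) (at t within {0..t + 1})"
    using \<open>0 < t\<close> by (intro integral_has_real_derivative cont) auto
  then show ?thesis
    using \<open>0 < t\<close> by (subst (asm) at_within_interior) auto
qed

section \<open>Integrals of the covariance of fractional Brownian motion\<close>

text \<open>All integrals of the covariance are expressed through two incomplete gamma-type integrals of the
  power $r^p$ against $e^{-r}$ and $e^r$; in \<open>volterra_exp\<close> the same two integrals occur.\<close>

locale powr_weights =
  fixes p :: real
  assumes p_pos: "0 < p"
begin

definition P :: "real \<Rightarrow> real" where "P x = integral {0..x} (\<lambda>r. exp (- r) * r powr p)"
definition Q :: "real \<Rightarrow> real" where "Q x = integral {0..x} (\<lambda>r. exp r * r powr p)"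

lemma P_0 [simp]: "P 0 = 0" and Q_0 [simp]: "Q 0 = 0"
  by (simp_all add: P_def Q_def)

lemma continuous_weights:
  "continuous_on {0..T} (\<lambda>r. exp (- r) * r powr p)" "continuous_on {0..T} (\<lambda>r. exp r * r powr p)"
  using p_pos by (intro continuous_on_mult continuous_on_powr_nonneg continuous_intros; simp)+

lemma DERIV_P: "0 < x \<Longrightarrow> (P has_real_derivative exp (- x) * x powr p) (at x)"
  and DERIV_Q: "0 < x \<Longrightarrow> (Q has_real_derivative exp x * x powr p) (at x)"
  unfolding P_def[abs_def] Q_def[abs_def] by (intro DERIV_integral_upper continuous_weights; simp)+

lemma continuous_P: "continuous_on {0..T} P" and continuous_Q: "continuous_on {0..T} Q"
  unfolding P_def[abs_def] Q_def[abs_def]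
  by (intro indefinite_integral_continuous_1 integrable_continuous_real continuous_weights)+

lemma continuous_P_reflect: "continuous_on {0..T} (\<lambda>x. P (T - x))"
  and continuous_Q_reflect: "continuous_on {0..T} (\<lambda>x. Q (T - x))"
  by (rule continuous_on_compose2[OF continuous_P[of T]] continuous_on_compose2[OF continuous_Q[of T]],
      intro continuous_intros, auto)+

lemma has_integral_exp_powr: "((\<lambda>u. exp u * u powr p) has_integral Q t) {0..t}"
  unfolding Q_def by (intro integrable_integral integrable_continuous_real continuous_weights)

lemma has_integral_exp:
  assumes "0 \<le> t"
  shows "(exp has_integral exp t - 1) {0..t :: real}"
proof -
  have "(exp has_integral exp t - exp 0) {0..t}"
  proof (rule fundamental_theorem_of_calculus[OF assms])
    fix x show "(exp has_vector_derivative exp x) (at x within {0..t})"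
      unfolding has_real_derivative_iff_has_vector_derivative[symmetric]
      by (rule has_field_derivative_at_within[OF DERIV_exp])
  qed
  then show ?thesis by simp
qed

text \<open>On either side of the kink at $u = s$ the substitution $r = |s - u|$ reduces the integrand to one of
  the two weights.\<close>

lemma has_integral_exp_abs_diff_powr:
  assumes "0 \<le> s" "s \<le> t"
  shows "((\<lambda>u. exp u * \<bar>s - u\<bar> powr p) has_integral exp s * (P s + Q (t - s))) {0..t}"
proof -
  have "((\<lambda>u. exp u * \<bar>s - u\<bar> powr p) has_integral - exp s * P (s - s) - - exp s * P (s - 0)) {0..s}"
  proof (rule fundamental_theorem_of_calculus_interior[OF assms(1)])
    show "continuous_on {0..s} (\<lambda>u. - exp s * P (s - u))"
      by (intro continuous_on_mult_left continuous_P_reflect)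
    fix u assume u: "u \<in> {0<..<s}"
    have "((\<lambda>u. P (s - u)) has_real_derivative exp (- (s - u)) * (s - u) powr p * (-1)) (at u)"
      using u by (intro DERIV_chain2[OF DERIV_P] derivative_eq_intros) auto
    from DERIV_cmult[OF this, of "- exp s"]
    have "((\<lambda>u. - exp s * P (s - u)) has_real_derivative (exp s * exp (- (s - u))) * (s - u) powr p) (at u)"
      by (simp add: mult.assoc)
    also have "exp s * exp (- (s - u)) = exp u" by (simp flip: exp_add)
    finally show "((\<lambda>u. - exp s * P (s - u)) has_vector_derivative exp u * \<bar>s - u\<bar> powr p) (at u)"
      using u by (simp add: has_real_derivative_iff_has_vector_derivative)
  qed
  moreover have "((\<lambda>u. exp u * \<bar>s - u\<bar> powr p) has_integral exp s * Q (t - s) - exp s * Q (s - s)) {s..t}"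
  proof (rule fundamental_theorem_of_calculus_interior[OF assms(2)])
    have "continuous_on {s..t} (\<lambda>u. Q (u - s))"
      by (rule continuous_on_compose2[OF continuous_Q[of "t - s"]]) (auto intro!: continuous_intros)
    then show "continuous_on {s..t} (\<lambda>u. exp s * Q (u - s))"
      by (rule continuous_on_mult_left)
    fix u assume u: "u \<in> {s<..<t}"
    have "((\<lambda>u. Q (u - s)) has_real_derivative exp (u - s) * (u - s) powr p * 1) (at u)"
      using u by (intro DERIV_chain2[OF DERIV_Q] derivative_eq_intros) auto
    from DERIV_cmult[OF this, of "exp s"]
    have "((\<lambda>u. exp s * Q (u - s)) has_real_derivative (exp s * exp (u - s)) * (u - s) powr p) (at u)"
      by (simp add: mult.assoc)
    also have "exp s * exp (u - s) = exp u" by (simp flip: exp_add)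
    finally show "((\<lambda>u. exp s * Q (u - s)) has_vector_derivative exp u * \<bar>s - u\<bar> powr p) (at u)"
      using u by (simp add: has_real_derivative_iff_has_vector_derivative)
  qed
  ultimately have "((\<lambda>u. exp u * \<bar>s - u\<bar> powr p) has_integral
      (- exp s * P (s - s) - - exp s * P (s - 0)) + (exp s * Q (t - s) - exp s * Q (s - s))) {0..t}"
    by (rule has_integral_combine[OF assms])
  then show ?thesis by (simp add: distrib_left)
qed

text \<open>An integration by parts turns the integral of \<open>P\<close> and \<open>Q\<close> against $e^{2s}$ back into \<open>P\<close> and
  \<open>Q\<close>: with the antiderivative \<open>?R\<close> the power terms cancel in pairs. This is the step in which the
  double integral of the covariance becomes a single one.\<close>

lemma has_integral_exp_outer:
  assumes "0 \<le> t"
  shows "((\<lambda>s. exp (2 * s) * (P s + Q (t - s))) has_integral exp (2 * t) * P t - Q t) {0..t}"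
proof -
  let ?R = "\<lambda>s. (exp (2 * s) * P s - Q s + exp (2 * s) * Q (t - s) - exp (2 * t) * P (t - s)) / 2"
  have "((\<lambda>s. exp (2 * s) * (P s + Q (t - s))) has_integral ?R t - ?R 0) {0..t}"
  proof (rule fundamental_theorem_of_calculus_interior[OF assms])
    show "continuous_on {0..t} ?R"
      by (intro continuous_on_divide continuous_on_diff continuous_on_add continuous_on_mult
        continuous_P continuous_Q continuous_P_reflect continuous_Q_reflect continuous_intros) auto
    fix s assume s: "s \<in> {0<..<t}"
    have P': "((\<lambda>u. P (t - u)) has_real_derivative exp (- (t - s)) * (t - s) powr p * (-1)) (at s)"
      using s by (intro DERIV_chain2[OF DERIV_P] derivative_eq_intros) auto
    have Q': "((\<lambda>u. Q (t - u)) has_real_derivative exp (t - s) * (t - s) powr p * (-1)) (at s)"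
      using s by (intro DERIV_chain2[OF DERIV_Q] derivative_eq_intros) auto
    have E: "((\<lambda>s. exp (2 * s)) has_real_derivative 2 * exp (2 * s)) (at s)"
      by (rule derivative_eq_intros refl)+ simp
    have "(?R has_real_derivative
        ((2 * exp (2 * s) * P s + exp (- s) * s powr p * exp (2 * s)) - exp s * s powr p
        + (2 * exp (2 * s) * Q (t - s) + exp (t - s) * (t - s) powr p * (-1) * exp (2 * s))
        - exp (2 * t) * (exp (- (t - s)) * (t - s) powr p * (-1))) / 2) (at s)"
      using s by (intro DERIV_cdivide DERIV_diff DERIV_add DERIV_mult DERIV_cmult DERIV_P DERIV_Q P' Q' E) auto
    also have "((2 * exp (2 * s) * P s + exp (- s) * s powr p * exp (2 * s)) - exp s * s powr p
        + (2 * exp (2 * s) * Q (t - s) + exp (t - s) * (t - s) powr p * (-1) * exp (2 * s))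
        - exp (2 * t) * (exp (- (t - s)) * (t - s) powr p * (-1))) / 2
      = exp (2 * s) * (P s + Q (t - s)) + ((exp (- s) * exp (2 * s)) - exp s) * s powr p / 2
        + (exp (2 * t) * exp (- (t - s)) - exp (t - s) * exp (2 * s)) * (t - s) powr p / 2"
      by (simp add: algebra_simps add_divide_distrib diff_divide_distrib)
    also have "exp (- s) * exp (2 * s) = exp s" by (simp flip: exp_add)
    also have "exp (2 * t) * exp (- (t - s)) = exp (t - s) * exp (2 * s)" by (simp flip: exp_add)
    finally show "(?R has_vector_derivative exp (2 * s) * (P s + Q (t - s))) (at s)"
      by (simp add: has_real_derivative_iff_has_vector_derivative)
  qed
  moreover have "?R t - ?R 0 = exp (2 * t) * P t - Q t"
    by (simp add: diff_divide_distrib)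
  ultimately show ?thesis by simp
qed

definition cov :: "real \<Rightarrow> real \<Rightarrow> real" where
  "cov s u = (s powr p + u powr p - \<bar>s - u\<bar> powr p) / 2"

lemma has_integral_exp_cov:
  assumes "0 \<le> s" "s \<le> t"
  shows "((\<lambda>u. exp u * cov s u) has_integral
    (s powr p * (exp t - 1) + Q t - exp s * (P s + Q (t - s))) / 2) {0..t}"
proof -
  have "((\<lambda>u. (s powr p * exp u + exp u * u powr p - exp u * \<bar>s - u\<bar> powr p) / 2) has_integral
    (s powr p * (exp t - 1) + Q t - exp s * (P s + Q (t - s))) / 2) {0..t}"
    using assms by (intro has_integral_divide has_integral_diff has_integral_add has_integral_mult_right
      has_integral_exp has_integral_exp_powr has_integral_exp_abs_diff_powr) auto
  then show ?thesis by (simp add: cov_def algebra_simps)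
qed

lemma has_integral_exp_exp_cov:
  assumes "0 \<le> t"
  shows "((\<lambda>s. exp s * integral {0..t} (\<lambda>u. exp u * cov s u)) has_integral
    (exp t - 1) * Q t - (exp (2 * t) * P t - Q t) / 2) {0..t}"
proof -
  have "((\<lambda>s. ((exp t - 1) * (exp s * s powr p) + Q t * exp s - exp (2 * s) * (P s + Q (t - s))) / 2) has_integral
    ((exp t - 1) * Q t + Q t * (exp t - 1) - (exp (2 * t) * P t - Q t)) / 2) {0..t}"
    using assms by (intro has_integral_divide has_integral_diff has_integral_add has_integral_mult_right
      has_integral_exp has_integral_exp_powr has_integral_exp_outer) auto
  moreover have "((exp t - 1) * (exp s * s powr p) + Q t * exp s - exp (2 * s) * (P s + Q (t - s))) / 2
      = exp s * integral {0..t} (\<lambda>u. exp u * cov s u)" if "s \<in> {0..t}" for s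
  proof -
    have "integral {0..t} (\<lambda>u. exp u * cov s u) = (s powr p * (exp t - 1) + Q t - exp s * (P s + Q (t - s))) / 2"
      using that by (intro integral_unique has_integral_exp_cov) auto
    then show ?thesis
      unfolding exp_double_real by (simp add: right_diff_distrib distrib_left mult_ac)
  qed
  ultimately have "((\<lambda>s. exp s * integral {0..t} (\<lambda>u. exp u * cov s u)) has_integral
    ((exp t - 1) * Q t + Q t * (exp t - 1) - (exp (2 * t) * P t - Q t)) / 2) {0..t}"
    by (rule has_integral_eq[rotated])
  then show ?thesis by (simp add: field_simps)
qed

text \<open>The left-hand side is the variance of $e^t B_t - \int_0^t e^s B_s\,ds$, expanded by bilinearity
  of the covariance.\<close>

lemma variance_eq_volterra:
  assumes "0 \<le> t"
  shows "(exp t)\<^sup>2 * cov t t - 2 * exp t * integral {0..t} (\<lambda>u. exp u * cov t u)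
    + integral {0..t} (\<lambda>s. exp s * integral {0..t} (\<lambda>u. exp u * cov s u)) = volterra (\<lambda>r. r powr p) t"
proof -
  have v: "volterra (\<lambda>r. r powr p) t = exp t * t powr p + exp (2 * t) / 2 * P t - Q t / 2"
    unfolding P_def Q_def using p_pos by (intro volterra_exp continuous_on_powr_nonneg) auto
  have single: "integral {0..t} (\<lambda>u. exp u * cov t u) = (t powr p * (exp t - 1) + Q t - exp t * P t) / 2"
    using integral_unique[OF has_integral_exp_cov[of t t]] assms by simp
  have double: "integral {0..t} (\<lambda>s. exp s * integral {0..t} (\<lambda>u. exp u * cov s u)) =
      (exp t - 1) * Q t - (exp (2 * t) * P t - Q t) / 2"
    by (rule integral_unique[OF has_integral_exp_exp_cov[OF assms]])
  have "cov t t = t powr p" using p_pos by (simp add: cov_def)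
  then show ?thesis
    unfolding v single double exp_double_real power2_eq_square by (simp add: field_simps)
qed

end

section \<open>Second moments of integrals of processes\<close>

text \<open>A process with continuous paths is jointly measurable, being the pointwise limit of its
  discretisations at the times $\lfloor ns \rfloor / n$. Negative times are clamped to $0$ so that
  no restricted sigma algebra is needed.\<close>

lemma measurable_continuous_paths:
  fixes B :: "real \<Rightarrow> 'a \<Rightarrow> real"
  assumes [measurable]: "\<And>s. 0 \<le> s \<Longrightarrow> B s \<in> borel_measurable M"
    and cont: "\<And>\<omega>. \<omega> \<in> space M \<Longrightarrow> continuous_on {0..} (\<lambda>s. B s \<omega>)"
  shows "(\<lambda>z. B (max 0 (fst z)) (snd z)) \<in> borel_measurable (borel \<Otimes>\<^sub>M M)"
proof (rule borel_measurable_LIMSEQ_real)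
  define k where "k n s = nat \<lfloor>max 0 s * Suc n\<rfloor>" for n and s :: real
  show "(\<lambda>z. B (k n (fst z) / Suc n) (snd z)) \<in> borel_measurable (borel \<Otimes>\<^sub>M M)" for n
  proof (rule measurable_compose_countable'[where f = "\<lambda>i z. B (real i / Suc n) (snd z)" and g = "\<lambda>z. k n (fst z)" and I = UNIV])
    show "(\<lambda>z. k n (fst z)) \<in> borel \<Otimes>\<^sub>M M \<rightarrow>\<^sub>M count_space UNIV"
      unfolding k_def by measurable
    show "(\<lambda>z. B (real i / real (Suc n)) (snd z)) \<in> borel_measurable (borel \<Otimes>\<^sub>M M)" for i
      by (rule measurable_compose[OF measurable_snd]) simp
  qed simp
  fix z :: "real \<times> 'a" assume z: "z \<in> space (borel \<Otimes>\<^sub>M M)"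
  let ?s = "max 0 (fst z)"
  have bounds: "?s - 1 / Suc n \<le> k n (fst z) / Suc n" "k n (fst z) / Suc n \<le> ?s" for n
  proof -
    have "0 \<le> ?s * Suc n" by simp
    then have "real (k n (fst z)) = of_int \<lfloor>?s * Suc n\<rfloor>" by (simp add: k_def)
    then have "?s * Suc n - 1 \<le> k n (fst z)" "k n (fst z) \<le> ?s * Suc n" by linarith+
    then show "?s - 1 / Suc n \<le> k n (fst z) / Suc n" "k n (fst z) / Suc n \<le> ?s"
      by (simp_all only: pos_le_divide_eq pos_divide_le_eq of_nat_0_less_iff zero_less_Suc left_diff_distrib)
         simp_all
  qed
  have "(\<lambda>n. ?s - 1 / Suc n) \<longlonglongrightarrow> ?s - 0"
    by (intro tendsto_diff tendsto_const LIMSEQ_Suc lim_const_over_n)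
  then have lower: "(\<lambda>n. ?s - 1 / Suc n) \<longlonglongrightarrow> ?s" by simp
  have "(\<lambda>n. k n (fst z) / Suc n) \<longlonglongrightarrow> ?s"
    by (rule tendsto_sandwich[OF _ _ lower tendsto_const]) (use bounds in auto)
  moreover have "continuous_on {0..} (\<lambda>s. B s (snd z))"
    using z by (intro cont) (auto simp: space_pair_measure)
  ultimately show "(\<lambda>n. B (k n (fst z) / Suc n) (snd z)) \<longlonglongrightarrow> B ?s (snd z)"
    by (intro continuous_on_tendsto_compose[where f = "\<lambda>s. B s (snd z)" and s = "{0..}"]) auto
qed

lemma integrable_mult_square:
  fixes f g :: "'a \<Rightarrow> real"
  assumes [measurable]: "f \<in> borel_measurable M" "g \<in> borel_measurable M"
    and "integrable M (\<lambda>x. (f x)\<^sup>2)" "integrable M (\<lambda>x. (g x)\<^sup>2)"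
  shows "integrable M (\<lambda>x. f x * g x)"
proof (rule Bochner_Integration.integrable_bound)
  show "integrable M (\<lambda>x. (f x)\<^sup>2 + (g x)\<^sup>2)" using assms by simp
  show "AE x in M. norm (f x * g x) \<le> norm ((f x)\<^sup>2 + (g x)\<^sup>2)"
  proof (rule AE_I2)
    fix x
    have "2 * \<bar>f x * g x\<bar> \<le> (f x)\<^sup>2 + (g x)\<^sup>2"
      using sum_squares_bound[of "\<bar>f x\<bar>" "\<bar>g x\<bar>"] by (simp add: abs_mult)
    then show "norm (f x * g x) \<le> norm ((f x)\<^sup>2 + (g x)\<^sup>2)" by simp
  qed
qed simp

text \<open>A jointly measurable process, indexed by a finite measure space, whose second moments are bounded:
  the setting in which integration over the index commutes with inner products in $L^2$.\<close>

locale second_order_process = prob_space M + N: finite_measure N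
  for M :: "'a measure" and N :: "'t measure" +
  fixes Z :: "'t \<Rightarrow> 'a \<Rightarrow> real" and K :: real
  assumes joint: "(\<lambda>z. Z (fst z) (snd z)) \<in> borel_measurable (N \<Otimes>\<^sub>M M)"
    and square_integrable: "\<And>s. s \<in> space N \<Longrightarrow> integrable M (\<lambda>\<omega>. (Z s \<omega>)\<^sup>2)"
    and second_moment: "\<And>s. s \<in> space N \<Longrightarrow> expectation (\<lambda>\<omega>. (Z s \<omega>)\<^sup>2) \<le> K"
begin

sublocale NM: pair_sigma_finite N M ..

lemma measurable_at: "s \<in> space N \<Longrightarrow> Z s \<in> borel_measurable M"
  using measurable_compose[OF measurable_Pair1' joint, of s] by simp

text \<open>Fubini's theorem applies because $|C Z_s| \le C^2 + Z_s^2$ has an expectation bounded in $s$.\<close>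

lemma expectation_mult_integral:
  assumes C: "C \<in> borel_measurable M" and C2: "integrable M (\<lambda>\<omega>. (C \<omega>)\<^sup>2)"
  shows "expectation (\<lambda>\<omega>. C \<omega> * (\<integral>s. Z s \<omega> \<partial>N)) = (\<integral>s. expectation (\<lambda>\<omega>. C \<omega> * Z s \<omega>) \<partial>N)"
proof -
  note [measurable] = joint C
  have meas: "(\<lambda>z. C (snd z) * Z (fst z) (snd z)) \<in> borel_measurable (N \<Otimes>\<^sub>M M)" by measurable
  have "integrable (N \<Otimes>\<^sub>M M) (\<lambda>z. C (snd z) * Z (fst z) (snd z))"
  proof (rule NM.Fubini_integrable[OF meas])
    have "integrable N (\<lambda>s. \<integral>\<omega>. \<bar>C \<omega> * Z s \<omega>\<bar> \<partial>M)"
    proof (rule N.integrable_const_bound)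
      show "AE s in N. norm (\<integral>\<omega>. \<bar>C \<omega> * Z s \<omega>\<bar> \<partial>M) \<le> expectation (\<lambda>\<omega>. (C \<omega>)\<^sup>2) + K"
      proof (rule AE_I2)
        fix s assume s: "s \<in> space N"
        have "(\<integral>\<omega>. \<bar>C \<omega> * Z s \<omega>\<bar> \<partial>M) \<le> expectation (\<lambda>\<omega>. (C \<omega>)\<^sup>2 + (Z s \<omega>)\<^sup>2)"
        proof (rule integral_mono)
          show "integrable M (\<lambda>\<omega>. \<bar>C \<omega> * Z s \<omega>\<bar>)"
            using s by (intro integrable_abs integrable_mult_square C measurable_at C2 square_integrable)
          show "integrable M (\<lambda>\<omega>. (C \<omega>)\<^sup>2 + (Z s \<omega>)\<^sup>2)"
            using s C2 square_integrable by simp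
          fix \<omega>
          have "2 * \<bar>C \<omega> * Z s \<omega>\<bar> \<le> (C \<omega>)\<^sup>2 + (Z s \<omega>)\<^sup>2"
            using sum_squares_bound[of "\<bar>C \<omega>\<bar>" "\<bar>Z s \<omega>\<bar>"] by (simp add: abs_mult)
          then show "\<bar>C \<omega> * Z s \<omega>\<bar> \<le> (C \<omega>)\<^sup>2 + (Z s \<omega>)\<^sup>2" by linarith
        qed
        also have "\<dots> \<le> expectation (\<lambda>\<omega>. (C \<omega>)\<^sup>2) + K"
          using C2 square_integrable[OF s] second_moment[OF s] by simp
        finally show "norm (\<integral>\<omega>. \<bar>C \<omega> * Z s \<omega>\<bar> \<partial>M) \<le> expectation (\<lambda>\<omega>. (C \<omega>)\<^sup>2) + K"
          by simp
      qed
      have "(\<lambda>(s, \<omega>). \<bar>C \<omega> * Z s \<omega>\<bar>) \<in> borel_measurable (N \<Otimes>\<^sub>M M)"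
        unfolding case_prod_unfold by measurable
      then show "(\<lambda>s. \<integral>\<omega>. \<bar>C \<omega> * Z s \<omega>\<bar> \<partial>M) \<in> borel_measurable N"
        by (rule borel_measurable_lebesgue_integral)
    qed
    then show "integrable N (\<lambda>s. \<integral>\<omega>. norm (C (snd (s, \<omega>)) * Z (fst (s, \<omega>)) (snd (s, \<omega>))) \<partial>M)"
      by simp
    show "AE s in N. integrable M (\<lambda>\<omega>. C (snd (s, \<omega>)) * Z (fst (s, \<omega>)) (snd (s, \<omega>)))"
      using C C2 measurable_at square_integrable by (intro AE_I2) (auto intro!: integrable_mult_square)
  qed
  then have "(\<integral>\<omega>. (\<integral>s. C \<omega> * Z s \<omega> \<partial>N) \<partial>M) = (\<integral>s. (\<integral>\<omega>. C \<omega> * Z s \<omega> \<partial>M) \<partial>N)"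
    by (intro NM.Fubini_integral) (simp add: case_prod_unfold)
  then show ?thesis by simp
qed

lemma measurable_integral: "(\<lambda>\<omega>. \<integral>s. Z s \<omega> \<partial>N) \<in> borel_measurable M"
proof -
  have "(\<lambda>(\<omega>, s). Z s \<omega>) \<in> borel_measurable (M \<Otimes>\<^sub>M N)"
    using measurable_compose[OF measurable_pair_swap' joint] by (simp add: case_prod_unfold)
  then show ?thesis by (rule N.borel_measurable_lebesgue_integral)
qed

text \<open>By the Cauchy-Schwarz inequality the square of $Y = \int Z_s\,ds$ is at most the total mass $m$
  times $\int Z_s^2\,ds$; it is obtained here from
  $0 \le \int (m Z_s - Y)^2\,ds = m \, (m \int Z_s^2\,ds - Y^2)$.\<close>

lemma integrable_square_integral: "integrable M (\<lambda>\<omega>. (\<integral>s. Z s \<omega> \<partial>N)\<^sup>2)"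
proof -
  have meas: "(\<lambda>z. (Z (fst z) (snd z))\<^sup>2) \<in> borel_measurable (N \<Otimes>\<^sub>M M)"
    using joint by measurable
  have "integrable (N \<Otimes>\<^sub>M M) (\<lambda>z. (Z (fst z) (snd z))\<^sup>2)"
  proof (rule NM.Fubini_integrable[OF meas])
    have "integrable N (\<lambda>s. \<integral>\<omega>. (Z s \<omega>)\<^sup>2 \<partial>M)"
    proof (rule N.integrable_const_bound)
      show "AE s in N. norm (\<integral>\<omega>. (Z s \<omega>)\<^sup>2 \<partial>M) \<le> K"
        using second_moment by (intro AE_I2) simp
      show "(\<lambda>s. \<integral>\<omega>. (Z s \<omega>)\<^sup>2 \<partial>M) \<in> borel_measurable N"
        by (rule borel_measurable_lebesgue_integral) (use meas in \<open>simp add: case_prod_unfold\<close>)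
    qed
    then show "integrable N (\<lambda>s. \<integral>\<omega>. norm ((Z (fst (s, \<omega>)) (snd (s, \<omega>)))\<^sup>2) \<partial>M)"
      by simp
    show "AE s in N. integrable M (\<lambda>\<omega>. (Z (fst (s, \<omega>)) (snd (s, \<omega>)))\<^sup>2)"
      using square_integrable by (intro AE_I2) simp
  qed
  then have I: "integrable (N \<Otimes>\<^sub>M M) (\<lambda>(s, \<omega>). (Z s \<omega>)\<^sup>2)"
    by (simp add: case_prod_unfold)
  have AE2: "AE \<omega> in M. integrable N (\<lambda>s. (Z s \<omega>)\<^sup>2)"
    using NM.AE_integrable_snd[OF I] .
  have M2: "integrable M (\<lambda>\<omega>. \<integral>s. (Z s \<omega>)\<^sup>2 \<partial>N)"
    using NM.integrable_snd[OF I] .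
  let ?m = "measure N (space N)"
  show ?thesis
  proof (rule Bochner_Integration.integrable_bound)
    show "integrable M (\<lambda>\<omega>. ?m * (\<integral>s. (Z s \<omega>)\<^sup>2 \<partial>N))" using M2 by simp
    show "(\<lambda>\<omega>. (\<integral>s. Z s \<omega> \<partial>N)\<^sup>2) \<in> borel_measurable M"
      using measurable_integral by measurable
    show "AE \<omega> in M. norm ((\<integral>s. Z s \<omega> \<partial>N)\<^sup>2) \<le> norm (?m * (\<integral>s. (Z s \<omega>)\<^sup>2 \<partial>N))"
      using AE2 AE_space
    proof eventually_elim
      case (elim \<omega>)
      then have i2: "integrable N (\<lambda>s. (Z s \<omega>)\<^sup>2)" by simp
      have m: "(\<lambda>s. Z s \<omega>) \<in> borel_measurable N"
        using measurable_compose[OF measurable_Pair2' joint] elim by simp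
      have i1: "integrable N (\<lambda>s. Z s \<omega>)"
        using integrable_mult_square[of "\<lambda>s. Z s \<omega>" N "\<lambda>s. 1"] m i2 by simp
      let ?Y = "\<integral>s. Z s \<omega> \<partial>N" and ?S = "\<integral>s. (Z s \<omega>)\<^sup>2 \<partial>N"
      have "0 \<le> (\<integral>s. (?m * Z s \<omega> - ?Y)\<^sup>2 \<partial>N)" by simp
      also have "\<dots> = (\<integral>s. ?m\<^sup>2 * (Z s \<omega>)\<^sup>2 - 2 * ?m * ?Y * Z s \<omega> + ?Y\<^sup>2 \<partial>N)"
        by (intro Bochner_Integration.integral_cong) (auto simp: power2_eq_square algebra_simps)
      also have "\<dots> = ?m\<^sup>2 * ?S - 2 * ?m * ?Y * ?Y + ?Y\<^sup>2 * ?m"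
        using i1 i2 by simp
      also have "\<dots> = ?m * (?m * ?S - ?Y\<^sup>2)"
        by (simp add: power2_eq_square algebra_simps)
      finally have *: "0 \<le> ?m * (?m * ?S - ?Y\<^sup>2)" .
      have "?Y\<^sup>2 \<le> ?m * ?S"
      proof (cases "?m = 0")
        case True
        then have "space N \<in> null_sets N"
          by (simp add: null_sets_def N.emeasure_eq_measure)
        then have "AE s in N. Z s \<omega> = 0" by (rule AE_I') auto
        then have "?Y = 0" by (rule integral_eq_zero_AE)
        then show ?thesis using True by simp
      next
        case False
        then have "0 < ?m" by (simp add: less_le)
        with * show ?thesis by (simp add: zero_le_mult_iff)
      qed
      moreover have "0 \<le> ?m * ?S" by simp
      ultimately show ?case by simp
    qed
  qed
qed

text \<open>The last term comes from applying \<open>expectation_mult_integral\<close> twice, first with the integral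
  itself as the fixed factor and then with the process at a fixed index.\<close>

lemma expectation_square_diff_integral:
  assumes C: "C \<in> borel_measurable M" and C2: "integrable M (\<lambda>\<omega>. (C \<omega>)\<^sup>2)"
  shows "expectation (\<lambda>\<omega>. (C \<omega> - (\<integral>s. Z s \<omega> \<partial>N))\<^sup>2) =
    expectation (\<lambda>\<omega>. (C \<omega>)\<^sup>2) - 2 * (\<integral>s. expectation (\<lambda>\<omega>. C \<omega> * Z s \<omega>) \<partial>N)
    + (\<integral>s. (\<integral>u. expectation (\<lambda>\<omega>. Z s \<omega> * Z u \<omega>) \<partial>N) \<partial>N)"
proof -
  let ?Y = "\<lambda>\<omega>. \<integral>s. Z s \<omega> \<partial>N"
  have CY: "integrable M (\<lambda>\<omega>. C \<omega> * ?Y \<omega>)"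
    by (intro integrable_mult_square C C2 measurable_integral integrable_square_integral)
  have "expectation (\<lambda>\<omega>. (C \<omega> - ?Y \<omega>)\<^sup>2) = expectation (\<lambda>\<omega>. (C \<omega>)\<^sup>2 - 2 * (C \<omega> * ?Y \<omega>) + (?Y \<omega>)\<^sup>2)"
    by (intro Bochner_Integration.integral_cong) (auto simp: power2_eq_square algebra_simps)
  also have "\<dots> = expectation (\<lambda>\<omega>. (C \<omega>)\<^sup>2) - 2 * expectation (\<lambda>\<omega>. C \<omega> * ?Y \<omega>) + expectation (\<lambda>\<omega>. (?Y \<omega>)\<^sup>2)"
    using C2 CY integrable_square_integral by simp
  also have "expectation (\<lambda>\<omega>. C \<omega> * ?Y \<omega>) = (\<integral>s. expectation (\<lambda>\<omega>. C \<omega> * Z s \<omega>) \<partial>N)"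
    by (rule expectation_mult_integral[OF C C2])
  also have "expectation (\<lambda>\<omega>. (?Y \<omega>)\<^sup>2) = (\<integral>s. expectation (\<lambda>\<omega>. ?Y \<omega> * Z s \<omega>) \<partial>N)"
    using expectation_mult_integral[OF measurable_integral integrable_square_integral]
    by (simp add: power2_eq_square)
  also have "\<dots> = (\<integral>s. (\<integral>u. expectation (\<lambda>\<omega>. Z s \<omega> * Z u \<omega>) \<partial>N) \<partial>N)"
  proof (rule Bochner_Integration.integral_cong[OF refl])
    fix s assume s: "s \<in> space N"
    have "expectation (\<lambda>\<omega>. ?Y \<omega> * Z s \<omega>) = expectation (\<lambda>\<omega>. Z s \<omega> * ?Y \<omega>)"
      by (simp only: mult.commute)
    also have "\<dots> = (\<integral>u. expectation (\<lambda>\<omega>. Z s \<omega> * Z u \<omega>) \<partial>N)"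
      by (rule expectation_mult_integral[OF measurable_at[OF s] square_integrable[OF s]])
    finally show "expectation (\<lambda>\<omega>. ?Y \<omega> * Z s \<omega>) = (\<integral>u. expectation (\<lambda>\<omega>. Z s \<omega> * Z u \<omega>) \<partial>N)" .
  qed
  finally show ?thesis .
qed

end

section \<open>The variance of the exponential integral\<close>

text \<open>The left endpoint is left out because the integrability of the square of a fractional Brownian
  motion at a time $t > 0$ is read off from its nonzero second moment.\<close>

lemma integral_Ioc_eq:
  fixes f :: "real \<Rightarrow> real"
  assumes "continuous_on {0..t} f"
  shows "(\<integral>s. f s \<partial>restrict_space lborel {0<..t}) = integral {0..t} f"
proof -
  have int: "set_integrable lborel {0..t} f"
    by (rule borel_integrable_atLeastAtMost'[OF assms])
  have "(\<integral>s. f s \<partial>restrict_space lborel {0<..t}) = (LINT s:{0<..t}|lborel. f s)"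
    by (simp add: integral_restrict_space set_lebesgue_integral_def)
  also have "\<dots> = (LINT s:{0..t}|lborel. f s)"
  proof (rule set_integral_cong_set)
    show "set_borel_measurable lborel {0..t} f"
      using int unfolding set_integrable_def set_borel_measurable_def by (rule borel_measurable_integrable)
    have "set_integrable lborel {0<..t} f"
      by (rule set_integrable_subset[OF int]) auto
    then show "set_borel_measurable lborel {0<..t} f"
      unfolding set_integrable_def set_borel_measurable_def by (rule borel_measurable_integrable)
    show "AE s in lborel. s \<in> {0..t} \<longleftrightarrow> s \<in> {0<..t}"
      using AE_lborel_singleton[of "0 :: real"] by eventually_elim auto
  qed
  also have "\<dots> = integral {0..t} f"
    by (rule set_borel_integral_eq_integral(2)[OF int])
  finally show ?thesis .
qed

context powr_weights
begin

lemma continuous_cov: "continuous_on ({0..} \<times> {0..}) (\<lambda>(s, u). cov s u)"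
  unfolding cov_def case_prod_unfold using p_pos
  by (intro continuous_on_divide continuous_on_diff continuous_on_add continuous_on_powr' continuous_intros) auto

lemma continuous_exp_cov:
  assumes "0 \<le> s"
  shows "continuous_on {0..t} (\<lambda>u. exp u * cov s u)"
  by (intro continuous_on_mult continuous_intros
      continuous_on_compose2[OF continuous_cov, of "{0..t}" "\<lambda>u. (s, u)", simplified])
     (use assms in auto)

lemma continuous_integral_exp_cov:
  "continuous_on {0..t} (\<lambda>s. exp s * integral {0..t} (\<lambda>u. exp u * cov s u))"
proof -
  have "continuous_on ({0..t} \<times> cbox 0 t) (\<lambda>(s, u). exp u * cov s u)"
    unfolding case_prod_unfold
    by (intro continuous_on_mult continuous_intros continuous_on_subset[OF continuous_cov[unfolded case_prod_unfold]]) auto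
  then have "continuous_on {0..t} (\<lambda>s. integral (cbox 0 t) (\<lambda>u. exp u * cov s u))"
    by (rule integral_continuous_on_param)
  then show ?thesis
    unfolding cbox_interval by (intro continuous_on_mult continuous_intros)
qed

end

lemma (in fractional_brownian_motion) measurable_B:
  assumes "0 \<le> t"
  shows "B t \<in> borel_measurable M"
proof -
  have "gaussian_rv M (\<lambda>\<omega>. \<Sum>s\<in>{t}. 1 * B s \<omega>)"
    using gaussian[unfolded gaussian_process_def, rule_format, of "{t}" "\<lambda>s. 1"] assms by simp
  then show ?thesis by (simp add: gaussian_rv_def)
qed

text \<open>The Bochner integral of a function that is not integrable is $0$, so the positive value of the
  second moment forces integrability.\<close>

lemma (in fractional_brownian_motion) second_moment_B:
  assumes "0 < t"
  shows "expectation (\<lambda>\<omega>. (B t \<omega>)\<^sup>2) = t powr (2 * H)"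
    and "integrable M (\<lambda>\<omega>. (B t \<omega>)\<^sup>2)"
proof -
  show *: "expectation (\<lambda>\<omega>. (B t \<omega>)\<^sup>2) = t powr (2 * H)"
    using covariance[of t t] assms hurst by (simp add: power2_eq_square)
  show "integrable M (\<lambda>\<omega>. (B t \<omega>)\<^sup>2)"
    using * assms not_integrable_integral_eq[of M "\<lambda>\<omega>. (B t \<omega>)\<^sup>2"] by fastforce
qed

text \<open>The exponential integral is the random variable $e^t B_t$ minus the integral of the
  process $e^s B_s$, so \<open>expectation_square_diff_integral\<close> expresses its second moment through the
  covariance.\<close>

lemma (in fractional_brownian_motion) variance_exp_integral:
  assumes t: "0 < t"
  shows "expectation (\<lambda>\<omega>. (exp_integral B t \<omega>)\<^sup>2) = volterra (\<lambda>r. r powr (2 * H)) t"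
proof -
  interpret W: powr_weights "2 * H" by unfold_locales (use hurst in simp)
  define N where "N = restrict_space lborel {0<..t}"
  define Z where "Z s \<omega> = exp s * B (max 0 s) \<omega>" for s \<omega>
  have space_N: "space N = {0<..t}" by (simp add: N_def space_restrict_space)
  have "finite_measure N"
    by (rule finite_measureI) (use t in \<open>simp add: N_def emeasure_restrict_space space_restrict_space\<close>)
  have cov: "expectation (\<lambda>\<omega>. B s \<omega> * B u \<omega>) = W.cov s u" if "0 \<le> s" "0 \<le> u" for s u
    using covariance that by (simp add: W.cov_def)
  have ZZ: "expectation (\<lambda>\<omega>. Z s \<omega> * Z u \<omega>) = exp s * (exp u * W.cov s u)" if "s \<in> space N" "u \<in> space N" for s u
  proof -
    have "expectation (\<lambda>\<omega>. Z s \<omega> * Z u \<omega>) = expectation (\<lambda>\<omega>. (exp s * exp u) * (B s \<omega> * B u \<omega>))"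
      using that by (simp add: Z_def space_N max_def mult_ac)
    then show ?thesis using that by (simp add: cov space_N)
  qed
  have CZ: "expectation (\<lambda>\<omega>. exp t * B t \<omega> * Z s \<omega>) = exp t * (exp s * W.cov t s)" if "s \<in> space N" for s
    using ZZ[of t s] that t by (simp add: Z_def space_N max_def)
  have Z2: "integrable M (\<lambda>\<omega>. (Z s \<omega>)\<^sup>2)" if "s \<in> space N" for s
    using second_moment_B(2)[of s] that by (simp add: Z_def space_N max_def power_mult_distrib)
  interpret S: second_order_process M N Z "(exp t)\<^sup>2 * t powr (2 * H)"
  proof (intro second_order_process.intro second_order_process_axioms.intro)
    show "(\<lambda>z. Z (fst z) (snd z)) \<in> borel_measurable (N \<Otimes>\<^sub>M M)"
    proof -
      have [measurable]: "(\<lambda>z. z) \<in> N \<Otimes>\<^sub>M M \<rightarrow>\<^sub>M borel \<Otimes>\<^sub>M M"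
      proof -
        have "(\<lambda>z. (fst z, snd z)) \<in> N \<Otimes>\<^sub>M M \<rightarrow>\<^sub>M borel \<Otimes>\<^sub>M M"
        proof (rule measurable_Pair)
          have "(\<lambda>s. s) \<in> N \<rightarrow>\<^sub>M borel" by (simp add: N_def measurable_restrict_space1)
          then show "fst \<in> N \<Otimes>\<^sub>M M \<rightarrow>\<^sub>M borel"
            using measurable_compose[OF measurable_fst, of "\<lambda>s. s" N borel M] by simp
        qed simp
        then show ?thesis by simp
      qed
      have "(\<lambda>z. exp (fst z) * B (max 0 (fst z)) (snd z)) \<in> borel_measurable (borel \<Otimes>\<^sub>M M)"
        by (intro borel_measurable_times measurable_continuous_paths measurable_B continuous_paths) simp_all
      from measurable_compose[OF \<open>(\<lambda>z. z) \<in> _\<close> this] show ?thesis by (simp add: Z_def)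
    qed
    fix s assume s: "s \<in> space N"
    have "expectation (\<lambda>\<omega>. (Z s \<omega>)\<^sup>2) = (exp s)\<^sup>2 * s powr (2 * H)"
      using second_moment_B(1)[of s] s by (simp add: Z_def space_N max_def power_mult_distrib)
    also have "\<dots> \<le> (exp t)\<^sup>2 * t powr (2 * H)"
      using s hurst by (intro mult_mono power_mono powr_mono2) (auto simp: space_N)
    finally show "expectation (\<lambda>\<omega>. (Z s \<omega>)\<^sup>2) \<le> (exp t)\<^sup>2 * t powr (2 * H)" .
  qed (use \<open>finite_measure N\<close> Z2 prob_space_axioms in auto)
  have path: "exp_integral B t \<omega> = exp t * B t \<omega> - (\<integral>s. Z s \<omega> \<partial>N)" if "\<omega> \<in> space M" for \<omega>
  proof -
    have c: "continuous_on {0..t} (\<lambda>s. exp s * B s \<omega>)"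
      using continuous_on_subset[OF continuous_paths[OF that], of "{0..t}"]
      by (intro continuous_on_mult continuous_intros) auto
    have "(\<integral>s. Z s \<omega> \<partial>N) = (\<integral>s. exp s * B s \<omega> \<partial>N)"
      by (intro Bochner_Integration.integral_cong) (auto simp: Z_def space_N)
    also have "\<dots> = integral {0..t} (\<lambda>s. exp s * B s \<omega>)"
      unfolding N_def by (rule integral_Ioc_eq[OF c])
    also have "\<dots> = (LBINT s:{0..t}. exp s * B s \<omega>)"
      by (rule set_borel_integral_eq_integral(2)[symmetric, OF borel_integrable_atLeastAtMost'[OF c]])
    finally show ?thesis by (simp add: exp_integral_def)
  qed
  have C: "(\<lambda>\<omega>. exp t * B t \<omega>) \<in> borel_measurable M"
    using measurable_B[of t] t by simp
  have C2: "integrable M (\<lambda>\<omega>. (exp t * B t \<omega>)\<^sup>2)"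
    using second_moment_B(2)[OF t] by (simp add: power_mult_distrib)
  have "expectation (\<lambda>\<omega>. (exp_integral B t \<omega>)\<^sup>2) = expectation (\<lambda>\<omega>. (exp t * B t \<omega> - (\<integral>s. Z s \<omega> \<partial>N))\<^sup>2)"
    by (intro Bochner_Integration.integral_cong) (auto simp: path)
  also have "\<dots> = expectation (\<lambda>\<omega>. (exp t * B t \<omega>)\<^sup>2) - 2 * (\<integral>s. expectation (\<lambda>\<omega>. exp t * B t \<omega> * Z s \<omega>) \<partial>N)
      + (\<integral>s. (\<integral>u. expectation (\<lambda>\<omega>. Z s \<omega> * Z u \<omega>) \<partial>N) \<partial>N)"
    by (rule S.expectation_square_diff_integral[OF C C2])
  also have "expectation (\<lambda>\<omega>. (exp t * B t \<omega>)\<^sup>2) = (exp t)\<^sup>2 * W.cov t t"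
    using cov[of t t] t unfolding power_mult_distrib by (simp add: power2_eq_square[of "B t _"])
  also have "(\<integral>s. expectation (\<lambda>\<omega>. exp t * B t \<omega> * Z s \<omega>) \<partial>N) = (\<integral>s. exp t * (exp s * W.cov t s) \<partial>N)"
    by (intro Bochner_Integration.integral_cong refl CZ)
  also have "\<dots> = exp t * integral {0..t} (\<lambda>u. exp u * W.cov t u)"
    unfolding N_def using t by (subst integral_mult_right_zero) (simp add: integral_Ioc_eq W.continuous_exp_cov)
  also have "(\<integral>s. (\<integral>u. expectation (\<lambda>\<omega>. Z s \<omega> * Z u \<omega>) \<partial>N) \<partial>N)
      = (\<integral>s. exp s * integral {0..t} (\<lambda>u. exp u * W.cov s u) \<partial>N)"
  proof (rule Bochner_Integration.integral_cong[OF refl])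
    fix s assume s: "s \<in> space N"
    have "(\<integral>u. expectation (\<lambda>\<omega>. Z s \<omega> * Z u \<omega>) \<partial>N) = (\<integral>u. exp s * (exp u * W.cov s u) \<partial>N)"
      by (intro Bochner_Integration.integral_cong refl ZZ s)
    also have "\<dots> = exp s * (\<integral>u. exp u * W.cov s u \<partial>N)" by simp
    also have "(\<integral>u. exp u * W.cov s u \<partial>N) = integral {0..t} (\<lambda>u. exp u * W.cov s u)"
      unfolding N_def using s by (intro integral_Ioc_eq W.continuous_exp_cov) (simp add: space_N)
    finally show "(\<integral>u. expectation (\<lambda>\<omega>. Z s \<omega> * Z u \<omega>) \<partial>N) = exp s * integral {0..t} (\<lambda>u. exp u * W.cov s u)" .
  qed
  also have "\<dots> = integral {0..t} (\<lambda>s. exp s * integral {0..t} (\<lambda>u. exp u * W.cov s u))"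
    unfolding N_def by (rule integral_Ioc_eq[OF W.continuous_integral_exp_cov])
  finally show ?thesis
    using W.variance_eq_volterra[of t] t by simp
qed

section \<open>Dependence on the exponent\<close>

lemma DERIV_powr_exponent:
  fixes r :: real
  assumes "0 \<le> r"
  shows "((\<lambda>q. r powr q) has_real_derivative r powr q * ln r) (at q within S)"
proof -
  have "((\<lambda>q. exp (q * ln r)) has_real_derivative exp (q * ln r) * ln r) (at q within S)"
    by (rule derivative_eq_intros refl)+ simp
  then show ?thesis
    by (cases "r = 0") (simp_all add: powr_def)
qed

text \<open>Differentiation under the integral sign. The exponents range over \<open>{p / 2..}\<close> because
  the derivative \<open>r powr p * ln r\<close> is jointly continuous up to $r = 0$ only for exponents bounded
  away from $0$.\<close>

lemma volterra_powr_has_derivative: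
  assumes "0 < p" "0 < t"
  shows "((\<lambda>p. volterra (\<lambda>r. r powr p) t) has_real_derivative volterra (\<lambda>r. r powr p * ln r) t) (at p)"
proof -
  let ?U = "{p / 2..}"
  have cont: "continuous_on (?U \<times> {0..t}) (\<lambda>z. sinh (t - snd z) * (snd z powr fst z * ln (snd z)))"
    using assms by (intro continuous_on_mult continuous_on_powr_ln_joint continuous_intros) simp
  have "((\<lambda>p. integral {0..t} (\<lambda>r. sinh (t - r) * r powr p)) has_field_derivative
      integral {0..t} (\<lambda>r. sinh (t - r) * (r powr p * ln r))) (at p within ?U)"
    unfolding interval_cbox
  proof (rule leibniz_rule_field_derivative)
    fix q r assume "q \<in> ?U" "r \<in> cbox 0 t"
    have "((\<lambda>q. r powr q) has_real_derivative r powr q * ln r) (at q within ?U)"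
      using \<open>r \<in> cbox 0 t\<close> by (intro DERIV_powr_exponent) auto
    then show "((\<lambda>q. sinh (t - r) * r powr q) has_real_derivative sinh (t - r) * (r powr q * ln r)) (at q within ?U)"
      by (rule DERIV_cmult)
  next
    fix q assume "q \<in> ?U"
    then have "continuous_on {0..t} (\<lambda>r. sinh (t - r) * r powr q)"
      using assms by (intro continuous_on_sinh_mult continuous_on_powr_nonneg) auto
    then show "(\<lambda>r. sinh (t - r) * r powr q) integrable_on cbox 0 t"
      unfolding cbox_interval by (rule integrable_continuous_real)
  next
    show "continuous_on (?U \<times> cbox 0 t) (\<lambda>(q, r). sinh (t - r) * (r powr q * ln r))"
      using cont by (simp only: case_prod_unfold cbox_interval)
  qed (use assms in simp_all)
  moreover have "at p within ?U = at p"
    using assms by (intro at_within_interior) (auto simp: interior_Ici[of "p / 2 - 1"])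
  ultimately have "((\<lambda>p. integral {0..t} (\<lambda>r. sinh (t - r) * r powr p)) has_field_derivative
      integral {0..t} (\<lambda>r. sinh (t - r) * (r powr p * ln r))) (at p)"
    by (simp only:)
  then show ?thesis
    unfolding volterra_def using assms by (intro DERIV_cmult DERIV_add DERIV_powr_exponent) auto
qed

lemma continuous_on_volterra_powr_ln:
  assumes "0 < q" "0 < t"
  shows "continuous_on {q..} (\<lambda>p. volterra (\<lambda>r. r powr p * ln r) t)"
proof -
  have cont: "continuous_on ({q..} \<times> {0..t}) (\<lambda>z. sinh (t - snd z) * (snd z powr fst z * ln (snd z)))"
    using assms by (intro continuous_on_mult continuous_on_powr_ln_joint continuous_intros)
  have "continuous_on {q..} (\<lambda>p. integral (cbox 0 t) (\<lambda>r. sinh (t - r) * (r powr p * ln r)))"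
    by (rule integral_continuous_on_param) (use cont in \<open>simp only: case_prod_unfold cbox_interval\<close>)
  moreover have "continuous_on {q..} (\<lambda>p. t powr p * ln t)"
    using assms by (intro continuous_on_mult continuous_on_powr continuous_intros) auto
  ultimately show ?thesis
    unfolding volterra_def cbox_interval by (intro continuous_on_mult_left continuous_on_add)
qed

lemma powr_ln_mono:
  fixes r :: real
  assumes "p \<le> q" "0 \<le> r"
  shows "r powr p * ln r \<le> r powr q * ln r"
proof (cases "r \<ge> 1")
  case True
  then show ?thesis using assms by (intro mult_right_mono powr_mono) auto
next
  case False
  show ?thesis
  proof (cases "r = 0")
    case r: False
    then show ?thesis using assms False by (intro mult_right_mono_neg powr_mono') auto
  qed auto
qed

lemma volterra_powr_ln_mono:
  assumes "0 < p" "p \<le> q" "0 < t"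
  shows "volterra (\<lambda>r. r powr p * ln r) t \<le> volterra (\<lambda>r. r powr q * ln r) t"
  by (rule volterra_mono)
     (use assms in \<open>auto intro!: powr_ln_mono continuous_on_powr_ln\<close>)

text \<open>This is the strict convexity of the variance in the Hurst index. Pointwise it holds because
  $r^q - r^p$ and $\ln r$ have the same sign for $p < q$.\<close>

lemma volterra_powr_ln_strict_mono:
  assumes "0 < p" "p < q" "0 < t"
  shows "volterra (\<lambda>r. r powr p * ln r) t < volterra (\<lambda>r. r powr q * ln r) t"
proof (rule volterra_strict_mono[where s = "min t 1 / 2"])
  let ?s = "min t 1 / 2"
  have s: "0 < ?s" "?s < 1" using assms by auto
  have "?s powr q < ?s powr p" using s assms by (intro powr_less_mono') auto
  then show "?s powr p * ln ?s < ?s powr q * ln ?s"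
    using s by (intro mult_strict_right_mono_neg) auto
qed (use assms in \<open>auto intro!: powr_ln_mono continuous_on_powr_ln\<close>)

lemma powr_le_affine:
  fixes r :: real
  assumes "0 \<le> p" "p \<le> 1" "0 \<le> r"
  shows "r powr p \<le> (1 - p) + p * r"
proof (cases "r = 0")
  case False
  then show ?thesis
    using Youngs_inequality_0[of "1 - p" p 1 r] assms by simp
qed (use assms in auto)

text \<open>By the weighted inequality of arithmetic and geometric means $r^p \le (1 - p) + p r$, and the operator
  maps $(1 - p) + p r$ to its value at the constant $1$, minus $p$.\<close>

lemma volterra_powr_le:
  assumes "0 < p" "p \<le> 1" "0 < t"
  shows "volterra (\<lambda>r. r powr p) t \<le> volterra (\<lambda>r. 1) t - p"
proof -
  have "volterra (\<lambda>r. r powr p) t \<le> volterra (\<lambda>r. (1 - p) + p * r + 0 * r\<^sup>2) t"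
    using assms powr_le_affine[of p]
    by (intro volterra_mono) (auto intro!: continuous_intros continuous_on_powr_nonneg)
  also have "\<dots> = (1 - p) * (exp t * cosh t) + p * (exp t * sinh t)"
    using assms by (subst volterra_quadratic) (auto simp: algebra_simps)
  also have "\<dots> = volterra (\<lambda>r. 1) t - p"
    using assms unfolding exp_cosh_real exp_sinh_real by (simp add: volterra_one field_simps)
  finally show ?thesis .
qed

text \<open>As $p$ tends to $0$, the right-hand side of the inequality tends to the value of the operator at the
  constant $1$, and the left-hand side is smaller than this limit by $1$. The quantitative form is
  $r^p = e^{p \ln r} \ge 1 + p \ln r$, and the logarithm is integrable at $0$.\<close>

lemma volterra_powr_gt:
  assumes "0 < t"
  obtains p where "0 < p" "p < 1" "volterra (\<lambda>r. r) t < volterra (\<lambda>r. r powr p) t"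
proof -
  \<comment> \<open>The bound below reads \<open>exp t * cosh t - p * A \<le> volterra (\<lambda>r. r powr p) t\<close>, and
    \<open>exp t * cosh t\<close> exceeds the value at exponent $1$ by $1$; so $p$ is chosen with \<open>p * A < 1\<close>.\<close>
  define A where "A = exp t * (sinh t * (t * t - t * ln t + t) - ln t)"
  define p where "p = 1 / (2 + \<bar>A\<bar>)"
  have p: "0 < p" "p < 1" by (auto simp: p_def)
  have "p * A < 1"
    unfolding p_def by (simp add: field_simps)
  \<comment> \<open>A minorant of \<open>sinh (t - r) * r powr p\<close> with an elementary antiderivative. Since \<open>ln r < t\<close>,
    the kernel in front of \<open>t - ln r\<close> may be replaced by its maximum \<open>sinh t\<close>. The value at $0$ is
    set to $0$ because \<open>0 powr p\<close> is $0$.\<close>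
  define h where "h r = (if r = 0 then 0 else sinh (t - r) - p * sinh t * (t - ln r))" for r
  define F where "F r = - cosh (t - r) - p * sinh t * (t * r - r powr 1 * ln r + r)" for r
  have "(h has_integral F t - F 0) {0..t}"
  proof (rule fundamental_theorem_of_calculus_interior)
    show "continuous_on {0..t} F"
      unfolding F_def by (intro continuous_on_add continuous_on_diff continuous_on_mult_left continuous_on_powr_ln continuous_intros) auto
    fix r assume r: "r \<in> {0<..<t}"
    have "((\<lambda>r. - cosh (t - r) - p * sinh t * (t * r - r * ln r + r)) has_real_derivative h r) (at r)"
      using r by (auto intro!: derivative_eq_intros simp: h_def)
    then have "(F has_real_derivative h r) (at r)"
      by (rule DERIV_cong_ev[THEN iffD1, OF refl _ refl, rotated])
         (use r in \<open>auto intro!: eventually_mono[OF eventually_nhds_in_open[of "{0<..<t}" r]] simp: F_def\<close>)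
    then show "(F has_vector_derivative h r) (at r)"
      by (simp add: has_real_derivative_iff_has_vector_derivative)
  qed (use assms in auto)
  moreover have "h r \<le> sinh (t - r) * r powr p" if r: "r \<in> {0..t}" for r
  proof (cases "r = 0")
    case False
    with r have "0 < r" by auto
    have "ln r < t" using ln_less_self[OF \<open>0 < r\<close>] r by auto
    have "1 + p * ln r \<le> exp (p * ln r)" by (rule exp_ge_add_one_self)
    also have "\<dots> = r powr p" using \<open>0 < r\<close> by (simp add: powr_def)
    finally have "sinh (t - r) * (1 + p * ln r) \<le> sinh (t - r) * r powr p"
      using r by (intro mult_left_mono) auto
    moreover have "p * (sinh (t - r) * (t - ln r)) \<le> p * (sinh t * (t - ln r))"
      using r p \<open>ln r < t\<close> by (intro mult_left_mono mult_right_mono) auto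
    moreover have "0 \<le> p * (sinh (t - r) * t)"
      using r p by auto
    ultimately show ?thesis using False by (simp add: h_def algebra_simps)
  qed (simp add: h_def)
  moreover have "(\<lambda>r. sinh (t - r) * r powr p) integrable_on {0..t}"
    using p by (auto intro!: integrable_continuous_real continuous_on_sinh_mult continuous_on_powr_nonneg)
  ultimately have "F t - F 0 \<le> integral {0..t} (\<lambda>r. sinh (t - r) * r powr p)"
    by (intro has_integral_le[OF _ integrable_integral]) auto
  then have I: "cosh t - 1 - p * (sinh t * (t * t - t * ln t + t)) \<le> integral {0..t} (\<lambda>r. sinh (t - r) * r powr p)"
    using assms by (simp add: F_def algebra_simps)
  have "1 + p * ln t \<le> t powr p"
    using exp_ge_add_one_self[of "p * ln t"] assms by (simp add: powr_def)
  with I have "exp t * (cosh t - p * (sinh t * (t * t - t * ln t + t) - ln t)) \<le> volterra (\<lambda>r. r powr p) t"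
    unfolding volterra_def by (intro mult_left_mono) (auto simp: algebra_simps)
  then have "exp t * cosh t - p * A \<le> volterra (\<lambda>r. r powr p) t"
    by (simp add: A_def right_diff_distrib mult.left_commute)
  moreover have "volterra (\<lambda>r. r) t = exp t * cosh t - 1"
    using assms unfolding exp_cosh_real by (simp add: volterra_id field_simps)
  ultimately have "volterra (\<lambda>r. r) t < volterra (\<lambda>r. r powr p) t"
    using \<open>p * A < 1\<close> by linarith
  then show thesis using that p by blast
qed

section \<open>The sign of the derivative in the exponent\<close>

lemma volterra_has_derivative:
  assumes cont: "\<And>T. continuous_on {0..T} f" and f': "(f has_real_derivative f') (at t)" and "0 < t"
  shows "(volterra f has_real_derivative
    exp (2 * t) * (exp (- t) * (f t + f') + integral {0..t} (\<lambda>r. exp (- r) * f r))) (at t)"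
proof -
  have FTC: "((\<lambda>x. integral {0..x} (\<lambda>r. g r * f r)) has_real_derivative g t * f t) (at t)"
    if "continuous_on UNIV g" for g
    using that \<open>0 < t\<close>
    by (intro DERIV_integral_upper continuous_on_mult cont) (auto intro: continuous_on_subset)
  have e: "exp (2 * t) * exp (- t) = exp t"
    by (simp flip: exp_add)
  have e2: "exp (2 * t) / 2 * (exp (- t) * f t) = exp t * f t / 2"
    by (simp add: e[symmetric])
  have "((\<lambda>t. exp t * f t + exp (2 * t) / 2 * integral {0..t} (\<lambda>r. exp (- r) * f r)
      - integral {0..t} (\<lambda>r. exp r * f r) / 2) has_real_derivative
      exp t * f t + exp t * f' + (exp (2 * t) * integral {0..t} (\<lambda>r. exp (- r) * f r)
      + exp (2 * t) / 2 * (exp (- t) * f t)) - exp t * f t / 2) (at t)"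
    by (rule derivative_eq_intros f' FTC continuous_intros refl | simp)+
  also have "exp t * f t + exp t * f' + (exp (2 * t) * integral {0..t} (\<lambda>r. exp (- r) * f r)
      + exp (2 * t) / 2 * (exp (- t) * f t)) - exp t * f t / 2 =
      (exp (2 * t) * exp (- t)) * (f t + f') + exp (2 * t) * integral {0..t} (\<lambda>r. exp (- r) * f r)"
    unfolding e2 unfolding e by (simp add: distrib_left)
  finally show ?thesis
    unfolding volterra_exp[OF cont, abs_def] by (simp add: distrib_left mult.assoc)
qed

text \<open>The expression is $e^{-2t}$ times the derivative found in \<open>volterra_has_derivative\<close>. In its own
  derivative everything but the second derivative of $f$ cancels.\<close>

lemma volterra_derivative_factor:
  assumes cont: "\<And>T. continuous_on {0..T} f"
    and f': "(f has_real_derivative f' t) (at t)"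
    and f'': "(f' has_real_derivative f'') (at t)" and "0 < t"
  shows "((\<lambda>t. exp (- t) * (f t + f' t) + integral {0..t} (\<lambda>r. exp (- r) * f r))
      has_real_derivative exp (- t) * f'') (at t)"
proof -
  have FTC: "((\<lambda>x. integral {0..x} (\<lambda>r. exp (- r) * f r)) has_real_derivative exp (- t) * f t) (at t)"
    using \<open>0 < t\<close> by (intro DERIV_integral_upper continuous_intros cont)
  show ?thesis
    by (rule derivative_eq_intros f' f'' FTC refl)+ (simp add: algebra_simps)
qed

text \<open>The derivative of \<open>volterra f\<close> is $e^{2t} K(t)$ with $K$ increasing beyond $1$. Between $1$,
  where the function is negative, and $a$, where it is not, $K$ is positive somewhere by the mean
  value theorem, hence everywhere after $a$.\<close>

lemma volterra_single_crossing:
  assumes cont: "\<And>T. continuous_on {0..T} f"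
    and f': "\<And>t. 1 \<le> t \<Longrightarrow> (f has_real_derivative f' t) (at t)"
    and f'': "\<And>t. 1 \<le> t \<Longrightarrow> (f' has_real_derivative f'' t) (at t)"
    and pos: "\<And>t. 1 < t \<Longrightarrow> 0 < f'' t"
    and neg: "volterra f 1 < 0" and ab: "1 < a" "0 \<le> volterra f a" "a < b"
  shows "0 < volterra f b"
proof -
  define K where "K t = exp (- t) * (f t + f' t) + integral {0..t} (\<lambda>r. exp (- r) * f r)" for t
  have D: "(volterra f has_real_derivative exp (2 * t) * K t) (at t)" if "1 \<le> t" for t
    unfolding K_def using that by (intro volterra_has_derivative cont f') auto
  have K: "K s < K t" if "1 \<le> s" "s < t" for s t
  proof -
    have "\<exists>z. s < z \<and> z < t \<and> K t - K s = (t - s) * (exp (- z) * f'' z)"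
      unfolding K_def using that
      by (intro MVT2 volterra_derivative_factor cont f' f'') auto
    then obtain z where "s < z" "z < t" "K t - K s = (t - s) * (exp (- z) * f'' z)" by blast
    moreover have "0 < (t - s) * (exp (- z) * f'' z)"
      using pos[of z] \<open>s < z\<close> that by auto
    ultimately show ?thesis by linarith
  qed
  obtain c where c: "1 < c" "c < a" "volterra f a - volterra f 1 = (a - 1) * (exp (2 * c) * K c)"
    using MVT2[of 1 a "volterra f" "\<lambda>t. exp (2 * t) * K t"] ab D by auto
  then have "0 < (a - 1) * (exp (2 * c) * K c)" using ab neg by linarith
  then have "0 < K c" using ab by (simp add: zero_less_mult_iff)
  obtain d where d: "a < d" "d < b" "volterra f b - volterra f a = (b - a) * (exp (2 * d) * K d)"
    using MVT2[of a b "volterra f" "\<lambda>t. exp (2 * t) * K t"] ab D by auto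
  have "0 < K d" using K[of c d] c d \<open>0 < K c\<close> by linarith
  then have "0 < (b - a) * (exp (2 * d) * K d)" using ab by auto
  then show ?thesis using d ab by linarith
qed

lemma volterra_powr_ln_neg:
  assumes "0 < p" "0 < t" "t \<le> 1"
  shows "volterra (\<lambda>r. r powr p * ln r) t < 0"
proof -
  have "volterra (\<lambda>r. r powr p * ln r) t < volterra (\<lambda>r. 0 + 0 * r + 0 * r\<^sup>2) t"
  proof (rule volterra_strict_mono)
    show "0 < t / 2" "t / 2 < t" using assms by auto
    show "(t / 2) powr p * ln (t / 2) < 0 + 0 * (t / 2) + 0 * (t / 2)\<^sup>2"
      using assms by (auto intro!: mult_pos_neg)
    fix r assume "0 \<le> r" "r \<le> t"
    then show "r powr p * ln r \<le> 0 + 0 * r + 0 * r\<^sup>2"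
      using assms by (cases "r = 0") (auto intro!: mult_nonneg_nonpos)
  qed (use assms in \<open>auto intro!: continuous_on_powr_ln\<close>)
  also have "\<dots> = 0" using assms by (subst volterra_quadratic) auto
  finally show ?thesis .
qed

text \<open>For $p \ge 1$ one has $r^p \ln r \ge r \ln r \ge r - 1$. The operator takes $r - 1$ to the constant
  $-1$, which alone would not suffice; but at the endpoint $t = e$ the gap between $r \ln r$ and its
  tangent $r - 1$ equals $1$ and contributes $e^t > 1$.\<close>

lemma volterra_powr_ln_pos_exp_one:
  assumes "1 \<le> p"
  shows "0 < volterra (\<lambda>r. r powr p * ln r) (exp 1)"
proof -
  let ?g = "\<lambda>r::real. r powr 1 * ln r" and ?l = "\<lambda>r::real. -1 + 1 * r + 0 * r\<^sup>2"
  have le: "?l r \<le> ?g r" if "0 \<le> r" for r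
  proof (cases "r = 0")
    case False
    with that have "r > 0" by auto
    have "- ln r \<le> 1 / r - 1" using ln_le_minus_one[of "1 / r"] \<open>r > 0\<close> by (simp add: ln_div)
    from mult_left_mono[OF this, of r] \<open>r > 0\<close> show ?thesis by (simp add: algebra_simps)
  qed auto
  have c: "continuous_on {0..exp 1} ?g" "continuous_on {0..exp 1} ?l"
    by (rule continuous_on_powr_ln; simp) (intro continuous_intros)
  have "exp (exp 1) * (?g (exp 1) - ?l (exp 1)) \<le> volterra (\<lambda>r. ?g r - ?l r) (exp 1)"
    by (rule volterra_ge) (use le c in \<open>auto intro!: continuous_on_diff\<close>)
  moreover have "volterra (\<lambda>r. ?g r - ?l r) (exp 1) = volterra ?g (exp 1) - volterra ?l (exp 1)"
    by (rule volterra_diff[OF c])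
  moreover have "volterra ?l (exp 1) = exp (exp 1) * sinh (exp 1) - exp (exp 1) * cosh (exp 1)"
    by (subst volterra_quadratic) (auto simp: algebra_simps)
  then have "volterra ?l (exp 1) = -1"
    unfolding exp_cosh_real exp_sinh_real by (simp add: field_simps)
  moreover have "exp (exp 1) * (?g (exp 1) - ?l (exp 1)) = exp (exp 1)" by simp
  moreover have "1 < exp (exp (1::real))" by (rule exp_gt_one) simp
  ultimately have "0 < volterra ?g (exp 1)" by linarith
  also have "\<dots> \<le> volterra (\<lambda>r. r powr p * ln r) (exp 1)"
    using assms by (intro volterra_powr_ln_mono) auto
  finally show ?thesis .
qed

text \<open>The second derivative of $r^p \ln r$ is $r^{p-2} (p (p-1) \ln r + 2p - 1)$, which is positive for
  $r > 1$ as soon as $p \ge 1$; so the crossing argument applies.\<close>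

lemma volterra_powr_ln_zero:
  assumes "1 \<le> p"
  obtains \<tau> where "0 < \<tau>" "volterra (\<lambda>r. r powr p * ln r) \<tau> = 0"
    "\<And>t. 0 < t \<Longrightarrow> t < \<tau> \<Longrightarrow> volterra (\<lambda>r. r powr p * ln r) t < 0"
    "\<And>t. \<tau> < t \<Longrightarrow> 0 < volterra (\<lambda>r. r powr p * ln r) t"
proof -
  define f where "f r = r powr p * ln r" for r :: real
  define f' where "f' r = p * r powr (p - 1) * ln r + r powr (p - 1)" for r
  define f'' where "f'' r = r powr (p - 2) * (p * (p - 1) * ln r + (2 * p - 1))" for r
  have cont: "continuous_on {0..T} f" for T
    unfolding f_def using assms by (intro continuous_on_powr_ln) auto
  have f': "(f has_real_derivative f' t) (at t)" if "0 < t" for t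
    unfolding f_def f'_def using that
    by (auto intro!: derivative_eq_intros simp: powr_diff field_simps)
  have f'': "(f' has_real_derivative f'' t) (at t)" if "1 \<le> t" for t
  proof -
    have "((\<lambda>r. r powr (p - 1)) has_real_derivative (p - 1) * t powr (p - 1 - 1)) (at t)"
      using that by (intro has_real_derivative_powr) auto
    moreover have "t powr (p - 1) = t * t powr (p - 2)" "t powr (p - 1 - 1) = t powr (p - 2)"
      using that by (simp_all add: powr_mult_base)
    ultimately show ?thesis
      unfolding f'_def f''_def using that by (auto intro!: derivative_eq_intros simp: algebra_simps)
  qed
  have pos: "0 < f'' t" if "1 < t" for t
    unfolding f''_def using that assms by (intro mult_pos_pos add_nonneg_pos) auto
  have neg: "volterra f t < 0" if "0 < t" "t \<le> 1" for t
    unfolding f_def using assms that by (intro volterra_powr_ln_neg) auto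
  have cross: "0 < volterra f b" if "0 \<le> volterra f a" "0 < a" "a < b" for a b
  proof -
    have "1 < a" using neg[of a] that by force
    then show ?thesis
      using that by (intro volterra_single_crossing[OF cont f' f'' pos neg]) auto
  qed
  have "isCont (volterra f) t" if "0 < t" for t
    using DERIV_isCont volterra_has_derivative[OF cont f'] that by blast
  moreover have "0 < volterra f (exp 1)"
    using volterra_powr_ln_pos_exp_one[OF assms] by (simp add: f_def[abs_def])
  ultimately have "\<exists>\<tau>\<ge>1. \<tau> \<le> exp 1 \<and> volterra f \<tau> = 0"
    using neg[of 1] by (intro IVT) auto
  then obtain \<tau> where \<tau>: "1 \<le> \<tau>" "volterra f \<tau> = 0" by blast
  have "volterra f t < 0" if "0 < t" "t < \<tau>" for t
    using cross[of t \<tau>] \<tau> that by force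
  with \<tau> cross[of \<tau>] show thesis
    by (intro that[of \<tau>]) (auto simp: f_def[abs_def])
qed

section \<open>The shape of the variance in the Hurst index\<close>

text \<open>The mean value theorem gives monotonicity on intervals avoiding $0$. At $0$, where
  \<open>\<phi>\<close> may jump, a comparison of \<open>\<phi> 0\<close> with the values at points close to $0$ takes
  its place.\<close>

lemma decreasing_then_increasing:
  fixes \<phi> :: "real \<Rightarrow> real"
  assumes der: "\<And>x. 0 < x \<Longrightarrow> x \<le> 1 \<Longrightarrow> (\<phi> has_real_derivative \<phi>' x) (at x within {0..1})"
    and mono: "\<And>x y. 0 < x \<Longrightarrow> x < y \<Longrightarrow> y \<le> 1 \<Longrightarrow> \<phi>' x < \<phi>' y"
    and zero: "0 < c" "\<And>x. 0 < x \<Longrightarrow> x \<le> c \<Longrightarrow> \<phi> x < \<phi> 0"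
    and h: "0 < h" "h \<le> 1"
  shows "\<phi>' h \<le> 0 \<Longrightarrow> strict_antimono_on {0..h} \<phi>"
    and "0 \<le> \<phi>' h \<Longrightarrow> strict_mono_on {h..1} \<phi>"
proof -
  have mvt: "\<exists>z. x < z \<and> z < y \<and> \<phi> y - \<phi> x = (y - x) * \<phi>' z" if "0 < x" "x < y" "y \<le> 1" for x y
  proof -
    have "continuous_on {x..y} \<phi>"
    proof (rule DERIV_continuous_on)
      fix u assume "u \<in> {x..y}"
      then show "(\<phi> has_real_derivative \<phi>' u) (at u within {x..y})"
        using that by (intro DERIV_subset[OF der]) auto
    qed
    moreover have D: "(\<phi> has_real_derivative \<phi>' u) (at u)" if "x < u" "u < y" for u :: real
    proof -
      have "at u within {0..1} = at u"
        using that \<open>0 < x\<close> \<open>y \<le> 1\<close> by (intro at_within_interior) auto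
      then show ?thesis using der[of u] that \<open>0 < x\<close> \<open>y \<le> 1\<close> by auto
    qed
    ultimately obtain l z where z: "x < z" "z < y" "DERIV \<phi> z :> l" "\<phi> y - \<phi> x = (y - x) * l"
      using MVT[of x y \<phi>] \<open>x < y\<close> unfolding real_differentiable_def by blast
    moreover have "l = \<phi>' z"
      using D[of z] z by (blast intro: DERIV_unique)
    ultimately show ?thesis by blast
  qed
  show "strict_antimono_on {0..h} \<phi>" if "\<phi>' h \<le> 0"
  proof -
    have anti: "\<phi> y < \<phi> x" if xy: "0 < x" "x < y" "y \<le> h" for x y
    proof -
      obtain z where z: "x < z" "z < y" "\<phi> y - \<phi> x = (y - x) * \<phi>' z"
        using mvt[of x y] xy h by auto
      then have "\<phi>' z < 0" using mono[of z h] \<open>\<phi>' h \<le> 0\<close> xy h by auto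
      then have "(y - x) * \<phi>' z < 0" using xy by (intro mult_pos_neg) auto
      then show ?thesis using z by linarith
    qed
    have "\<phi> y < \<phi> 0" if "0 < y" "y \<le> h" for y
    proof -
      \<comment> \<open>A point below \<open>y\<close> at which the values of \<open>\<phi>\<close> are known to lie below \<open>\<phi> 0\<close>.\<close>
      define x where "x = min c (y / 2)"
      have "0 < x" "x < y" "x \<le> c" using \<open>0 < c\<close> that by (auto simp: x_def)
      then show ?thesis using anti[of x y] zero(2)[of x] that by auto
    qed
    with anti show ?thesis
      by (intro monotone_onI) (metis atLeastAtMost_iff order_le_less)
  qed
  show "strict_mono_on {h..1} \<phi>" if "0 \<le> \<phi>' h"
  proof (rule strict_mono_onI)
    fix x y assume xy: "x \<in> {h..1}" "y \<in> {h..1}" "x < y"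
    then obtain z where z: "x < z" "z < y" "\<phi> y - \<phi> x = (y - x) * \<phi>' z"
      using mvt[of x y] h by auto
    then have "0 < \<phi>' z" using mono[of h z] that xy h by auto
    then have "0 < (y - x) * \<phi>' z" using xy by auto
    then show "\<phi> x < \<phi> y" using z by linarith
  qed
qed

text \<open>By the mean value theorem in the exponent, since some exponent below $1$ gives a larger value than
  the exponent $1$ does.\<close>

lemma volterra_powr_ln_neg_near_zero:
  assumes "0 < t"
  obtains p where "0 < p" "p < 1" "volterra (\<lambda>r. r powr p * ln r) t < 0"
proof -
  obtain p where p: "0 < p" "p < 1" "volterra (\<lambda>r. r) t < volterra (\<lambda>r. r powr p) t"
    using volterra_powr_gt[OF assms] .
  have "volterra (\<lambda>r. r powr 1) t = volterra (\<lambda>r. r) t"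
    using assms by (intro volterra_cong) auto
  with p obtain z where z: "p < z" "z < 1"
    "volterra (\<lambda>r. r) t - volterra (\<lambda>r. r powr p) t = (1 - p) * volterra (\<lambda>r. r powr z * ln r) t"
    using MVT2[of p 1 "\<lambda>p. volterra (\<lambda>r. r powr p) t" "\<lambda>p. volterra (\<lambda>r. r powr p * ln r) t"]
      volterra_powr_has_derivative[OF _ assms] by fastforce
  then have "(1 - p) * volterra (\<lambda>r. r powr z * ln r) t < 0" using p by linarith
  then show thesis
    using p z by (intro that[of z]) (auto simp: mult_less_0_iff)
qed

lemma V_eq_volterra:
  fixes M :: "real \<Rightarrow> 'a measure"
  assumes fbm: "\<And>H. 0 < H \<Longrightarrow> H < 1 \<Longrightarrow> fractional_brownian_motion (M H) H (B H)"
    and "0 < H" "H \<le> 1" "0 < t"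
  shows "V M B H t = volterra (\<lambda>r. r powr (2 * H)) t"
proof (cases "H = 1")
  case True
  have "volterra (\<lambda>r. r powr (2 * 1)) t = volterra (\<lambda>r. r\<^sup>2) t"
    using \<open>0 < t\<close> by (intro volterra_cong) (auto simp: powr_numeral)
  then show ?thesis
    using True \<open>0 < t\<close> by (simp add: V_def volterra_square)
next
  case False
  then show ?thesis
    using assms fractional_brownian_motion.variance_exp_integral[OF fbm[of H]] by (simp add: V_def)
qed

text \<open>At $H = 1$ this is the one-sided derivative that \<open>tau_one\<close> refers to; for $H < 1$ it is the
  two-sided one.\<close>

lemma V_has_derivative:
  fixes M :: "real \<Rightarrow> 'a measure"
  assumes fbm: "\<And>H. 0 < H \<Longrightarrow> H < 1 \<Longrightarrow> fractional_brownian_motion (M H) H (B H)"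
    and H: "0 < H" "H \<le> 1" and t: "0 < t"
  shows "((\<lambda>H. V M B H t) has_real_derivative 2 * volterra (\<lambda>r. r powr (2 * H) * ln r) t) (at H within {0..1})"
proof (rule has_field_derivative_transform_within)
  have "((\<lambda>H. volterra (\<lambda>r. r powr (2 * H)) t) has_real_derivative volterra (\<lambda>r. r powr (2 * H) * ln r) t * 2) (at H)"
    using H t by (intro DERIV_chain2[OF volterra_powr_has_derivative]) (auto intro!: derivative_eq_intros)
  then show "((\<lambda>H. volterra (\<lambda>r. r powr (2 * H)) t) has_real_derivative 2 * volterra (\<lambda>r. r powr (2 * H) * ln r) t) (at H within {0..1})"
    by (simp add: has_field_derivative_at_within mult.commute)
  show "0 < H" "H \<in> {0..1}" using H by auto
  fix x assume x: "x \<in> {0..1}" "dist x H < H"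
  then have "0 < x" using H by (auto simp: dist_real_def)
  then show "volterra (\<lambda>r. r powr (2 * x)) t = V M B x t"
    using x t V_eq_volterra[OF fbm] by simp
qed

lemma V_shape:
  fixes M :: "real \<Rightarrow> 'a measure"
  assumes fbm: "\<And>H. 0 < H \<Longrightarrow> H < 1 \<Longrightarrow> fractional_brownian_motion (M H) H (B H)"
    and h: "0 < h" "h \<le> 1" and t: "0 < t"
  shows "volterra (\<lambda>r. r powr (2 * h) * ln r) t \<le> 0 \<Longrightarrow> strict_antimono_on {0..h} (\<lambda>H. V M B H t)"
    and "0 \<le> volterra (\<lambda>r. r powr (2 * h) * ln r) t \<Longrightarrow> strict_mono_on {h..1} (\<lambda>H. V M B H t)"
proof -
  let ?\<phi> = "\<lambda>H. V M B H t" and ?\<phi>' = "\<lambda>H. 2 * volterra (\<lambda>r. r powr (2 * H) * ln r) t"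
  have der: "(?\<phi> has_real_derivative ?\<phi>' x) (at x within {0..1})" if "0 < x" "x \<le> 1" for x
    using V_has_derivative[OF fbm that t] .
  have mono: "?\<phi>' x < ?\<phi>' y" if "0 < x" "x < y" "y \<le> 1" for x y
    using volterra_powr_ln_strict_mono[of "2 * x" "2 * y" t] that t by simp
  have zero: "?\<phi> x < ?\<phi> 0" if x: "0 < x" "x \<le> 1 / 2" for x
  proof -
    have "?\<phi> 0 = volterra (\<lambda>r. 1) t"
      using t by (simp add: V_def volterra_one)
    then show ?thesis
      using volterra_powr_le[of "2 * x" t] x t V_eq_volterra[OF fbm, of x t] by simp
  qed
  show "strict_antimono_on {0..h} ?\<phi>" if "volterra (\<lambda>r. r powr (2 * h) * ln r) t \<le> 0"
    by (rule decreasing_then_increasing(1)[where c = "1 / 2", OF der mono _ zero h]) (use that in auto)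
  show "strict_mono_on {h..1} ?\<phi>" if "0 \<le> volterra (\<lambda>r. r powr (2 * h) * ln r) t"
    by (rule decreasing_then_increasing(2)[where c = "1 / 2", OF der mono _ zero h]) (use that in auto)
qed

lemma V_has_derivative_zero_iff:
  fixes M :: "real \<Rightarrow> 'a measure"
  assumes fbm: "\<And>H. 0 < H \<Longrightarrow> H < 1 \<Longrightarrow> fractional_brownian_motion (M H) H (B H)"
    and H: "0 < H" "H \<le> 1" and t: "0 < t"
  shows "((\<lambda>H. V M B H t) has_real_derivative 0) (at H within {0..1}) \<longleftrightarrow>
    volterra (\<lambda>r. r powr (2 * H) * ln r) t = 0"
proof
  assume "((\<lambda>H. V M B H t) has_real_derivative 0) (at H within {0..1})"
  moreover have "at H within {0..1} \<noteq> bot"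
    using H islimpt_Icc[of 0 1 H] by (auto simp: trivial_limit_within)
  ultimately show "volterra (\<lambda>r. r powr (2 * H) * ln r) t = 0"
    using has_field_derivative_unique[OF _ V_has_derivative[OF fbm H t], of 0] by simp
next
  assume "volterra (\<lambda>r. r powr (2 * H) * ln r) t = 0"
  then show "((\<lambda>H. V M B H t) has_real_derivative 0) (at H within {0..1})"
    using V_has_derivative[OF fbm H t] by simp
qed

theorem corollary3p9:
  fixes M :: "real \<Rightarrow> 'a measure"
    and B :: "real \<Rightarrow> real \<Rightarrow> 'a \<Rightarrow> real"
  assumes fbm: "\<And>H. 0 < H \<Longrightarrow> H < 1 \<Longrightarrow> fractional_brownian_motion (M H) H (B H)"
  shows "(\<forall>t. 0 < t \<and> t \<le> tau_one M B \<longrightarrow>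
            strict_antimono_on {0..1} (\<lambda>H. V M B H t)) \<and>
         (\<forall>t. tau_one M B < t \<and> t \<le> tau_half M B \<longrightarrow>
            (\<exists>Ht. 1/2 \<le> Ht \<and> (t < tau_half M B \<longrightarrow> 1/2 < Ht) \<and> Ht < 1 \<and>
               strict_antimono_on {0..Ht} (\<lambda>H. V M B H t) \<and>
               strict_mono_on {Ht..1} (\<lambda>H. V M B H t))) \<and>
         (\<forall>t. tau_half M B < t \<longrightarrow>
            (\<exists>Ht. 0 < Ht \<and> Ht < 1/2 \<and>
               strict_antimono_on {0..Ht} (\<lambda>H. V M B H t) \<and>
               strict_mono_on {Ht..1} (\<lambda>H. V M B H t)))"
proof -
  define D where "D H t = volterra (\<lambda>r. r powr (2 * H) * ln r) t" for H t
  obtain \<tau>1 where \<tau>1: "0 < \<tau>1" "D 1 \<tau>1 = 0"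
    "\<And>t. 0 < t \<Longrightarrow> t < \<tau>1 \<Longrightarrow> D 1 t < 0" "\<And>t. \<tau>1 < t \<Longrightarrow> 0 < D 1 t"
    by (rule volterra_powr_ln_zero[of "2 * 1", folded D_def]) (simp, blast)
  obtain \<tau>2 where \<tau>2: "0 < \<tau>2" "D (1 / 2) \<tau>2 = 0"
    "\<And>t. 0 < t \<Longrightarrow> t < \<tau>2 \<Longrightarrow> D (1 / 2) t < 0" "\<And>t. \<tau>2 < t \<Longrightarrow> 0 < D (1 / 2) t"
    by (rule volterra_powr_ln_zero[of "2 * (1 / 2)", folded D_def]) (simp, blast)
  note zero_iff = V_has_derivative_zero_iff[OF fbm, folded D_def]
  have tau_one: "tau_one M B = \<tau>1"
    unfolding tau_one_def
  proof (rule the_equality)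
    show "0 < \<tau>1 \<and> ((\<lambda>H. V M B H \<tau>1) has_real_derivative 0) (at 1 within {0..1})"
      using \<tau>1 zero_iff[of 1 \<tau>1] by simp
    fix t assume "0 < t \<and> ((\<lambda>H. V M B H t) has_real_derivative 0) (at 1 within {0..1})"
    then have "0 < t" "D 1 t = 0" using zero_iff[of 1 t] by simp_all
    then show "t = \<tau>1" using \<tau>1(3)[of t] \<tau>1(4)[of t] by force
  qed
  have tau_half: "tau_half M B = \<tau>2"
    unfolding tau_half_def
  proof (rule the_equality)
    have half: "at (1 / 2 :: real) within {0..1} = at (1 / 2)"
      by (intro at_within_interior) auto
    show "0 < \<tau>2 \<and> ((\<lambda>H. V M B H \<tau>2) has_real_derivative 0) (at (1 / 2))"
      using \<tau>2 zero_iff[of "1 / 2" \<tau>2] half by simp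
    fix t assume "0 < t \<and> ((\<lambda>H. V M B H t) has_real_derivative 0) (at (1 / 2))"
    then have "0 < t" "D (1 / 2) t = 0" using zero_iff[of "1 / 2" t] half by simp_all
    then show "t = \<tau>2" using \<tau>2(3)[of t] \<tau>2(4)[of t] by force
  qed
  note shape = V_shape[OF fbm, folded D_def]
  have D_mono: "D x t < D y t" if "0 < x" "x < y" "0 < t" for x y t
    unfolding D_def using that by (intro volterra_powr_ln_strict_mono) auto
  have turning: "\<exists>h. x \<le> h \<and> h \<le> y \<and> D h t = 0" if "0 < x" "x \<le> y" "D x t \<le> 0" "0 \<le> D y t" "0 < t" for x y t
  proof (rule IVT')
    show "continuous_on {x..y} (\<lambda>h. D h t)"
      unfolding D_def
      by (rule continuous_on_compose2[OF continuous_on_volterra_powr_ln[of "2 * x" t]])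
         (use that in \<open>auto intro!: continuous_intros\<close>)
  qed (use that in auto)
  show ?thesis
    unfolding tau_one tau_half
  proof (intro conjI allI impI)
    fix t assume t: "0 < t \<and> t \<le> \<tau>1"
    then have "D 1 t \<le> 0" using \<tau>1(2) \<tau>1(3)[of t] by (cases "t = \<tau>1") auto
    then show "strict_antimono_on {0..1} (\<lambda>H. V M B H t)"
      using t by (intro shape(1)) auto
  next
    fix t assume t: "\<tau>1 < t \<and> t \<le> \<tau>2"
    then have "0 < t" using \<tau>1 by simp
    have "0 < D 1 t" using \<tau>1(4) t by simp
    have le: "D (1 / 2) t \<le> 0" using \<tau>2(2) \<tau>2(3)[of t] t \<open>0 < t\<close> by (cases "t = \<tau>2") auto
    obtain h where h: "1 / 2 \<le> h" "h \<le> 1" "D h t = 0"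
      using turning[of "1 / 2" 1 t] le \<open>0 < D 1 t\<close> \<open>0 < t\<close> by auto
    have "1 / 2 < h" if "t < \<tau>2"
      using \<tau>2(3)[of t] that \<open>0 < t\<close> h by (cases "h = 1 / 2") auto
    moreover have "h < 1" using h \<open>0 < D 1 t\<close> by (cases "h = 1") auto
    moreover have "strict_antimono_on {0..h} (\<lambda>H. V M B H t)" "strict_mono_on {h..1} (\<lambda>H. V M B H t)"
      using h \<open>0 < t\<close> by (intro shape; simp)+
    ultimately show "\<exists>Ht. 1/2 \<le> Ht \<and> (t < \<tau>2 \<longrightarrow> 1/2 < Ht) \<and> Ht < 1 \<and>
               strict_antimono_on {0..Ht} (\<lambda>H. V M B H t) \<and>
               strict_mono_on {Ht..1} (\<lambda>H. V M B H t)"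
      using h(1) by blast
  next
    fix t assume t: "\<tau>2 < t"
    then have "0 < t" using \<tau>2 by simp
    have pos: "0 < D (1 / 2) t" using \<tau>2(4) t by simp
    obtain p where p: "0 < p" "p < 1" "D (p / 2) t < 0"
      using volterra_powr_ln_neg_near_zero[OF \<open>0 < t\<close>] unfolding D_def by auto
    obtain h where h: "p / 2 \<le> h" "h \<le> 1 / 2" "D h t = 0"
      using turning[of "p / 2" "1 / 2" t] p pos \<open>0 < t\<close> by auto
    have "0 < h" using h p by simp
    moreover have "h < 1 / 2" using h pos by (cases "h = 1 / 2") auto
    moreover have "strict_antimono_on {0..h} (\<lambda>H. V M B H t)" "strict_mono_on {h..1} (\<lambda>H. V M B H t)"
      using h \<open>0 < h\<close> \<open>0 < t\<close> by (intro shape; simp)+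
    ultimately show "\<exists>Ht. 0 < Ht \<and> Ht < 1/2 \<and>
               strict_antimono_on {0..Ht} (\<lambda>H. V M B H t) \<and>
               strict_mono_on {Ht..1} (\<lambda>H. V M B H t)"
      by blast
  qed
qed

end
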